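(* Two different two-qubit pure states $|\psi\rangle$ and $|\psi'\rangle$ have the same optimal CHSH operator if and only if they can be written as $$|\psi\rangle=(U_A\otimes U_B)(\cos\theta|00\rangle+\sin\theta|11\rangle),\qquad |\psi'\rangle=(U_A\otimes U_B)(\sin\theta|00\rangle+\cos\theta|11\rangle)$$ for some unitaries $U_A,U_B$ on $\mathbb{C}^2$ and some $\theta\in[0,\pi)$. In that case the operators $(U_A\otimes U_B)S_{\theta+}(U_A\otimes U_B)^\dagger$ and $(U_A\otimes U_B)S_{\theta-}(U_A\otimes U_B)^\dagger$ are optimal CHSH operators for both $|\psi\rangle$ and $|\psi'\rangle$, where $$S_{\theta+}=\frac{2}{\sqrt{1+\sin^2 2\theta}}\big(\sin 2\theta\,\sigma_x\otimes\sigma_x+\sigma_z\otimes\sigma_z\big),\quad S_{\theta-}=\frac{2}{\sqrt{1+\sin^2 2\theta}}\big(-\sin 2\theta\,\sigma_y\otimes\sigma_y+\sigma_z\otimes\sigma_z\big).$$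
   Context: $\sigma_x,\sigma_y,\sigma_z$ are the Pauli matrices, $\vec\sigma=(\sigma_x,\sigma_y,\sigma_z)$. A CHSH operator is an operator $S=A\otimes(B+B')+A'\otimes(B-B')$ with $A=\vec a\cdot\vec\sigma$, $A'=\vec a'\cdot\vec\sigma$, $B=\vec b\cdot\vec\sigma$, $B'=\vec b'\cdot\vec\sigma$ for unit vectors $\vec a,\vec a',\vec b,\vec b'\in\mathbb{R}^3$. The nonlocality of a two-qubit state $\rho$ is $\mathcal{N}(\rho)=\max_S\mathrm{tr}(\rho S)$ over all CHSH operators; $S$ is an optimal CHSH operator of $\rho$ if $\mathrm{tr}(\rho S)=\mathcal{N}(\rho)$. Two states have the same optimal CHSH operator if some CHSH operator is optimal for both. *)

theory Defs
  imports "HOL-Analysis.Analysis"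
begin

text \<open>Two-qubit Hilbert space C^2 (x) C^2 is modelled as complex^(2 \<times> 2);
  the index (i,j) corresponds to the basis vector |i j>, i,j in {0,1}.
  Single-qubit operators are complex^2^2, two-qubit operators complex^(2\<times>2)^(2\<times>2).\<close>

type_synonym qop = "complex^2^2"
type_synonym qqvec = "complex^(2\<times>2)"
type_synonym qqop = "complex^(2\<times>2)^(2\<times>2)"

definition sigma_x :: qop where
  "sigma_x = (\<chi> i j. if i = j then 0 else 1)"

definition sigma_y :: qop where
  "sigma_y = (\<chi> i j. if i = j then 0 else if i = 0 then - \<i> else \<i>)"

definition sigma_z :: qop where
  "sigma_z = (\<chi> i j. if i \<noteq> j then 0 else if i = 0 then 1 else -1)"

definition kron :: "qop \<Rightarrow> qop \<Rightarrow> qqop" where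
  "kron A B = (\<chi> p q. A $ fst p $ fst q * B $ snd p $ snd q)"

definition cadj :: "complex^'n^'m \<Rightarrow> complex^'m^'n" where
  "cadj A = (\<chi> i j. cnj (A $ j $ i))"

definition unitary :: "complex^'n^'n \<Rightarrow> bool" where
  "unitary U \<longleftrightarrow> cadj U ** U = mat 1"

definition pauli_dot :: "real^3 \<Rightarrow> qop" where
  "pauli_dot a = a$1 *\<^sub>R sigma_x + a$2 *\<^sub>R sigma_y + a$3 *\<^sub>R sigma_z"

definition is_CHSH :: "qqop \<Rightarrow> bool" where
  "is_CHSH S \<longleftrightarrow> (\<exists>a a' b b' :: real^3.
     norm a = 1 \<and> norm a' = 1 \<and> norm b = 1 \<and> norm b' = 1 \<and>
     S = kron (pauli_dot a) (pauli_dot b + pauli_dot b')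
       + kron (pauli_dot a') (pauli_dot b - pauli_dot b'))"

definition dens :: "qqvec \<Rightarrow> qqop" where
  "dens \<psi> = (\<chi> i j. \<psi> $ i * cnj (\<psi> $ j))"

text \<open>tr(rho S); real for Hermitian S, so we take the real part.\<close>
definition chsh_value :: "qqop \<Rightarrow> qqop \<Rightarrow> real" where
  "chsh_value \<rho> S = Re (trace (\<rho> ** S))"

definition nonlocality :: "qqop \<Rightarrow> real" where
  "nonlocality \<rho> = (SUP S\<in>{S. is_CHSH S}. chsh_value \<rho> S)"

definition optimal_CHSH :: "qqop \<Rightarrow> qqop \<Rightarrow> bool" where
  "optimal_CHSH \<rho> S \<longleftrightarrow> is_CHSH S \<and> chsh_value \<rho> S = nonlocality \<rho>"

definition same_optimal_CHSH :: "qqop \<Rightarrow> qqop \<Rightarrow> bool" where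
  "same_optimal_CHSH \<rho> \<rho>' \<longleftrightarrow> (\<exists>S. optimal_CHSH \<rho> S \<and> optimal_CHSH \<rho>' S)"

text \<open>Equality of pure states = equality of vectors up to a global phase.\<close>
definition same_state :: "qqvec \<Rightarrow> qqvec \<Rightarrow> bool" where
  "same_state \<psi> \<phi> \<longleftrightarrow> (\<exists>c. cmod c = 1 \<and> \<psi> = c *s \<phi>)"

definition ket :: "2 \<Rightarrow> 2 \<Rightarrow> qqvec" where
  "ket i j = axis (i,j) 1"

definition S_plus :: "real \<Rightarrow> qqop" where
  "S_plus \<theta> = (2 / sqrt (1 + (sin (2*\<theta>))\<^sup>2)) *\<^sub>R
     (sin (2*\<theta>) *\<^sub>R kron sigma_x sigma_x + kron sigma_z sigma_z)"

definition S_minus :: "real \<Rightarrow> qqop" where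
  "S_minus \<theta> = (2 / sqrt (1 + (sin (2*\<theta>))\<^sup>2)) *\<^sub>R
     (- sin (2*\<theta>) *\<^sub>R kron sigma_y sigma_y + kron sigma_z sigma_z)"

end

theory Submission
  imports Defs
begin

text \<open>
  Conjugating by a local unitary \<open>U \<otimes> V\<close> brings every CHSH operator to the form
  \<open>\<alpha> X \<otimes> X + \<gamma> Z \<otimes> Z\<close> with \<open>0 \<le> \<alpha> \<le> \<gamma>\<close> and \<open>\<alpha>\<^sup>2 + \<gamma>\<^sup>2 = 4\<close>: this is the singular value
  decomposition of its \<open>3 \<times> 3\<close> coefficient matrix, which has rank at most two and Frobenius norm 2.
  For a unit vector with concurrence \<open>C\<close>, let \<open>A\<close> and \<open>B\<close> be the expectations of \<open>Z \<otimes> Z\<close> and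
  \<open>X \<otimes> X\<close>. With \<open>q = |\<psi>\<^sub>0\<^sub>1|\<^sup>2 + |\<psi>\<^sub>1\<^sub>0|\<^sup>2\<close>, \<open>x = 2|\<psi>\<^sub>0\<^sub>0 \<psi>\<^sub>1\<^sub>1| \<le> 1 - q\<close> and \<open>y = 2|\<psi>\<^sub>0\<^sub>1 \<psi>\<^sub>1\<^sub>0| \<le> q\<close> one has
  \<open>A = 1 - 2q\<close>, \<open>|B| \<le> x + y\<close> and \<open>C \<ge> |x - y|\<close>, so \<open>A\<^sup>2 + B\<^sup>2 \<le> 1 + C\<^sup>2\<close> reduces to
  \<open>xy \<le> q(1 - q)\<close>. By Cauchy-Schwarz the value \<open>\<gamma>A + \<alpha>B\<close> is at most \<open>2 sqrt (1 + C\<^sup>2)\<close>, and the Schmidt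
  decomposition shows that this bound is attained, so it is the nonlocality.
  Equality forces \<open>q = 0\<close> and \<open>\<psi>\<close> to be, up to a phase, \<open>r|00> + s|11>\<close> with \<open>r, s \<ge> 0\<close> and
  \<open>2rs = \<alpha>/\<gamma>\<close>. This leaves exactly two states for a given operator, differing by exchanging \<open>r\<close> and \<open>s\<close>.
\<close>

subsection \<open>Tensor products and unitaries\<close>

text \<open>\<open>UNIV_2\<close> lists the elements of the type \<open>2\<close> as 1 and 2, while
  kets and matrices are indexed here by 0 and 1; the two agree because numerals of this type are
  taken modulo 2.\<close>

lemma UNIV_2_eq: "(UNIV :: 2 set) = {0, 1}"
proof -
  have "(2::2) = 0" by simp
  then show ?thesis by (simp only: UNIV_2) blast
qed

lemma sum_2_01: "sum f (UNIV :: 2 set) = f 0 + f 1"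
  by (simp add: UNIV_2_eq)

lemma forall_2_01: "(\<forall>i::2. P i) \<longleftrightarrow> P 0 \<and> P 1"
proof -
  have "(\<forall>i::2. P i) \<longleftrightarrow> (\<forall>i\<in>UNIV. P i)" by simp
  then show ?thesis by (simp only: UNIV_2_eq) simp
qed

lemma sum_22: "sum f (UNIV :: (2 \<times> 2) set) = f (0,0) + f (0,1) + f (1,0) + f (1,1)"
  by (simp add: UNIV_Times_UNIV[symmetric] UNIV_2_eq sum.cartesian_product[symmetric] add.assoc del: UNIV_Times_UNIV)

lemma kron_mult: "kron A B ** kron C D = kron (A ** C) (B ** D)"
  by (simp add: kron_def matrix_matrix_mult_def vec_eq_iff sum_22 sum_2_01 algebra_simps)

lemma kron_scaleR_left: "kron (r *\<^sub>R A) B = r *\<^sub>R kron A B"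
  by (simp add: kron_def vec_eq_iff)

lemma kron_scaleR_right: "kron A (r *\<^sub>R B) = r *\<^sub>R kron A B"
  by (simp add: kron_def vec_eq_iff)

lemma cadj_mult: "cadj (A ** B) = cadj B ** cadj A"
  by (simp add: cadj_def matrix_matrix_mult_def vec_eq_iff mult.commute)

lemma cadj_cadj [simp]: "cadj (cadj A) = A"
  by (simp add: cadj_def vec_eq_iff)

lemma cadj_mat_1 [simp]: "cadj (mat 1) = mat 1"
  by (auto simp add: cadj_def vec_eq_iff mat_def)

lemma cadj_kron: "cadj (kron A B) = kron (cadj A) (cadj B)"
  by (simp add: cadj_def kron_def vec_eq_iff)

lemma kron_mat_1 [simp]: "kron (mat 1) (mat 1) = mat 1"
  by (auto simp add: kron_def vec_eq_iff mat_def)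

lemma unitary_right: "unitary U \<Longrightarrow> U ** cadj U = mat 1"
  by (simp add: unitary_def matrix_left_right_inverse)

lemma unitary_kron: "unitary U \<Longrightarrow> unitary V \<Longrightarrow> unitary (kron U V)"
  by (simp add: unitary_def cadj_kron kron_mult)

lemma unitary_conj_cancel: "unitary U \<Longrightarrow> cadj U ** (U ** A) = A"
  by (simp add: unitary_def matrix_mul_assoc)

lemma dens_mult: "dens (W *v \<psi>) = W ** dens \<psi> ** cadj W"
  by (simp add: dens_def cadj_def matrix_matrix_mult_def matrix_vector_mult_def vec_eq_iff
      sum_22 algebra_simps)

text \<open>By cyclicity of the trace, the leading \<open>W\<close> moves to the end and cancels
  there against \<open>cadj W\<close>.\<close>

lemma chsh_value_unitary:
  assumes "unitary W"
  shows "chsh_value (dens (W *v \<psi>)) (W ** S ** cadj W) = chsh_value (dens \<psi>) S"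
proof -
  have "dens (W *v \<psi>) ** (W ** S ** cadj W) = W ** (dens \<psi> ** S ** cadj W)"
    using assms by (simp add: dens_mult unitary_conj_cancel flip: matrix_mul_assoc)
  then have "trace (dens (W *v \<psi>) ** (W ** S ** cadj W)) = trace (dens \<psi> ** S ** cadj W ** W)"
    by (simp only: trace_mul_sym[of W])
  also have "dens \<psi> ** S ** cadj W ** W = dens \<psi> ** S"
    using assms by (simp add: unitary_def flip: matrix_mul_assoc)
  finally show ?thesis by (simp add: chsh_value_def)
qed

lemma dens_phase:
  assumes "cmod c = 1" shows "dens (c *s \<phi>) = dens \<phi>"
proof -
  have "c * cnj c = 1" using assms by (metis complex_norm_square of_real_1 power_one)
  then have "(c * x) * (cnj c * y) = x * y" for x y
    by (metis mult.assoc mult.commute mult.left_neutral)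
  then show ?thesis by (simp add: dens_def vec_eq_iff)
qed

lemma dens_same_state: "same_state \<psi> \<phi> \<Longrightarrow> dens \<psi> = dens \<phi>"
  by (auto simp: same_state_def dens_phase)

text \<open>The squared norm is the trace of \<open>dens \<phi>\<close>, so cyclicity of the trace
  applies again.\<close>

lemma norm_unitary:
  assumes "unitary (W :: qqop)" shows "norm (W *v \<psi>) = norm \<psi>"
proof -
  have *: "complex_of_real ((norm \<phi>)\<^sup>2) = trace (dens \<phi>)" for \<phi> :: qqvec
    by (simp add: norm_vec_def L2_set_def dens_def trace_def sum_nonneg complex_norm_square del: of_real_power)
  have "trace (dens (W *v \<psi>)) = trace (W ** (dens \<psi> ** cadj W))"
    by (simp add: dens_mult matrix_mul_assoc)
  also have "\<dots> = trace (dens \<psi> ** cadj W ** W)"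
    by (simp only: trace_mul_sym[of W])
  also have "dens \<psi> ** cadj W ** W = dens \<psi>"
    using assms by (simp add: unitary_def flip: matrix_mul_assoc)
  finally have "complex_of_real ((norm (W *v \<psi>))\<^sup>2) = complex_of_real ((norm \<psi>)\<^sup>2)" by (simp only: *)
  then have "(norm (W *v \<psi>))\<^sup>2 = (norm \<psi>)\<^sup>2" by (simp only: of_real_eq_iff)
  then show ?thesis by simp
qed

subsection \<open>Pauli matrices\<close>

lemma sigma_entries:
  "sigma_x $ 0 $ 0 = 0" "sigma_x $ 0 $ 1 = 1" "sigma_x $ 1 $ 0 = 1" "sigma_x $ 1 $ 1 = 0"
  "sigma_y $ 0 $ 0 = 0" "sigma_y $ 0 $ 1 = - \<i>" "sigma_y $ 1 $ 0 = \<i>" "sigma_y $ 1 $ 1 = 0"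
  "sigma_z $ 0 $ 0 = 1" "sigma_z $ 0 $ 1 = 0" "sigma_z $ 1 $ 0 = 0" "sigma_z $ 1 $ 1 = - 1"
  by (simp_all add: sigma_x_def sigma_y_def sigma_z_def)

lemma pauli_dot_entries:
  "pauli_dot a $ 0 $ 0 = of_real (a$3)" "pauli_dot a $ 0 $ 1 = Complex (a$1) (- (a$2))"
  "pauli_dot a $ 1 $ 0 = Complex (a$1) (a$2)" "pauli_dot a $ 1 $ 1 = of_real (- (a$3))"
  by (simp_all add: pauli_dot_def sigma_entries complex_eq_iff)

lemma qop_eq_iff:
  "(A :: qop) = B \<longleftrightarrow> A$0$0 = B$0$0 \<and> A$0$1 = B$0$1 \<and> A$1$0 = B$1$0 \<and> A$1$1 = B$1$1"
  by (simp add: vec_eq_iff forall_2_01)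

lemma qop_mult_nth: "((A :: qop) ** B) $ i $ j = A$i$0 * B$0$j + A$i$1 * B$1$j"
  by (simp add: matrix_matrix_mult_def sum_2_01)

lemma cadj_nth [simp]: "cadj A $ i $ j = cnj (A $ j $ i)"
  by (simp add: cadj_def)

lemma mat_1_entries:
  "(mat 1 :: qop) $ 0 $ 0 = 1" "(mat 1 :: qop) $ 0 $ 1 = 0"
  "(mat 1 :: qop) $ 1 $ 0 = 0" "(mat 1 :: qop) $ 1 $ 1 = 1"
  by (simp_all add: mat_def)

lemma inner_real3: "(a :: real^3) \<bullet> b = a$1 * b$1 + a$2 * b$2 + a$3 * b$3"
  by (simp add: inner_vec_def sum_3)

lemma pauli_dot_add: "pauli_dot (a + b) = pauli_dot a + pauli_dot b"
  by (simp add: pauli_dot_def algebra_simps)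

lemma pauli_dot_diff: "pauli_dot (a - b) = pauli_dot a - pauli_dot b"
  by (simp add: pauli_dot_def algebra_simps)

lemma pauli_dot_scaleR: "pauli_dot (r *\<^sub>R a) = r *\<^sub>R pauli_dot a"
  by (simp add: pauli_dot_def algebra_simps)

lemma pauli_dot_axis:
  "pauli_dot (axis 1 1) = sigma_x" "pauli_dot (axis 2 1) = sigma_y" "pauli_dot (axis 3 1) = sigma_z"
  by (simp_all add: pauli_dot_def axis_def)

lemma cadj_pauli_dot [simp]: "cadj (pauli_dot a) = pauli_dot a"
  by (simp add: qop_eq_iff pauli_dot_entries complex_eq_iff)

text \<open>The Clifford relation: the cross product part of a product of two Pauli vectors is
  antisymmetric and cancels in the symmetrized product.\<close>

lemma pauli_dot_anticommute:
  "pauli_dot a ** pauli_dot b + pauli_dot b ** pauli_dot a = (2 * (a \<bullet> b)) *\<^sub>R mat 1"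
  by (simp add: qop_eq_iff qop_mult_nth pauli_dot_entries mat_1_entries complex_eq_iff inner_real3
      algebra_simps)

lemma pauli_dot_square:
  assumes "norm a = 1" shows "pauli_dot a ** pauli_dot a = mat 1"
proof -
  have "a \<bullet> a = 1" using assms by (simp add: norm_eq_1)
  then have "2 *\<^sub>R (pauli_dot a ** pauli_dot a) = 2 *\<^sub>R mat 1"
    using pauli_dot_anticommute[of a a] by (simp add: scaleR_2)
  then show ?thesis by simp
qed

section \<open>Unitaries as rotations of the Bloch sphere\<close>

lemma pauli_dot_exists:
  assumes "cadj A = A" "A $ 0 $ 0 + A $ 1 $ 1 = 0"
  shows "\<exists>a. A = pauli_dot a"
proof
  have h: "A $ i $ j = cnj (A $ j $ i)" for i j
    by (subst assms(1)[symmetric]) simp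
  have h0: "Im (A $ 0 $ 0) = 0" using arg_cong[OF h[of 0 0], of Im] by simp
  have h1: "Re (A $ 0 $ 1) = Re (A $ 1 $ 0)" "Im (A $ 0 $ 1) = - Im (A $ 1 $ 0)"
    using h[of 0 1] by simp_all
  show "A = pauli_dot (vector [Re (A$1$0), Im (A$1$0), Re (A$0$0)])"
    using h0 h1 assms(2) by (simp add: qop_eq_iff pauli_dot_entries complex_eq_iff)
qed

text \<open>Conjugation preserves being Hermitian and traceless, which gives some vector
  \<open>b\<close>; it also preserves squaring to the identity, which gives \<open>b\<close> unit
  length.\<close>

lemma pauli_dot_unitary_conj:
  assumes "unitary U" "norm a = 1"
  shows "\<exists>b. norm b = 1 \<and> U ** pauli_dot a ** cadj U = pauli_dot b"
proof -
  let ?A = "U ** pauli_dot a ** cadj U"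
  have "cadj ?A = ?A" by (simp add: cadj_mult matrix_mul_assoc)
  moreover have "?A $ 0 $ 0 + ?A $ 1 $ 1 = 0"
  proof -
    have *: "trace (B::qop) = B $ 0 $ 0 + B $ 1 $ 1" for B by (simp add: trace_def sum_2_01)
    have "trace ?A = trace (U ** (pauli_dot a ** cadj U))" by (simp add: matrix_mul_assoc)
    also have "\<dots> = trace (pauli_dot a ** cadj U ** U)" by (simp only: trace_mul_sym[of U])
    also have "pauli_dot a ** cadj U ** U = pauli_dot a"
      using assms by (simp add: unitary_def flip: matrix_mul_assoc)
    finally show ?thesis by (simp add: * pauli_dot_entries)
  qed
  ultimately obtain b where b: "?A = pauli_dot b" using pauli_dot_exists by blast
  have "?A ** ?A = U ** (pauli_dot a ** (cadj U ** (U ** (pauli_dot a ** cadj U))))"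
    by (simp add: matrix_mul_assoc)
  also have "\<dots> = U ** (pauli_dot a ** pauli_dot a) ** cadj U"
    using assms by (simp add: unitary_conj_cancel flip: matrix_mul_assoc)
  also have "\<dots> = mat 1"
    using assms by (simp add: pauli_dot_square unitary_right)
  finally have "(2 * (b \<bullet> b)) *\<^sub>R (mat 1 :: qop) = mat 1 + mat 1"
    using pauli_dot_anticommute[of b b] b by simp
  then have "b \<bullet> b = 1"
    by (simp add: qop_eq_iff mat_1_entries complex_eq_iff)
  then show ?thesis using b norm_eq_1 by blast
qed

lemma pauli_dot_eigenvector:
  assumes "norm a = 1"
  obtains v :: "complex^2" where "pauli_dot a *v v = v" "(cmod (v$0))\<^sup>2 + (cmod (v$1))\<^sup>2 = 1"
proof -
  \<comment> \<open>The generic choice is the first column of 1 + \<open>pauli_dot a\<close>, a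
    multiple of the projection onto the eigenvalue 1. It vanishes only at the south pole, where the
    second basis vector serves instead.\<close>
  define w :: "complex^2" where
    "w = (if a$3 = -1 then (\<chi> i. if i = 0 then 0 else 1)
          else (\<chi> i. if i = 0 then of_real (1 + a$3) else Complex (a$1) (a$2)))"
  have a: "(a$1)\<^sup>2 + (a$2)\<^sup>2 + (a$3)\<^sup>2 = 1"
    using assms by (simp add: norm_eq_1 inner_real3 power2_eq_square)
  have w: "pauli_dot a *v w = w"
  proof (cases "a$3 = -1")
    case True
    then have "a$1 = 0" "a$2 = 0" using a by (simp_all add: sum_power2_eq_zero_iff)
    then show ?thesis using True
      by (simp add: w_def vec_eq_iff forall_2_01 matrix_vector_mult_def sum_2_01 pauli_dot_entries
          complex_eq_iff)
  next
    case False
    then show ?thesis using a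
      by (auto simp add: w_def vec_eq_iff forall_2_01 matrix_vector_mult_def sum_2_01 pauli_dot_entries
          complex_eq_iff algebra_simps power2_eq_square)
  qed
  have "w \<noteq> 0" by (auto simp add: w_def vec_eq_iff forall_2_01 complex_eq_iff)
  define v where "v = (1 / norm w) *\<^sub>R w"
  have "norm v = 1" using \<open>w \<noteq> 0\<close> by (simp add: v_def)
  then have "(cmod (v$0))\<^sup>2 + (cmod (v$1))\<^sup>2 = 1"
    by (simp add: norm_vec_def L2_set_def sum_2_01)
  moreover have "pauli_dot a *v v = v"
    using w by (simp add: v_def vec_eq_iff forall_2_01 matrix_vector_mult_def sum_2_01 algebra_simps)
      (simp flip: scaleR_add_right)
  ultimately show ?thesis using that by blast
qed

text \<open>Lifts to a unitary the rotation that carries the x and z axes to \<open>e\<close> and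
  \<open>f\<close>. An eigenbasis of \<open>pauli_dot f\<close> fixes \<open>U\<close> up to phases;
  taking the second column to be the image of the first under \<open>pauli_dot e\<close> fixes the
  relative phase, so that \<open>sigma_x\<close> comes out exactly.\<close>

lemma orthonormal_pauli_conj:
  assumes "norm e = 1" "norm f = 1" "e \<bullet> f = 0"
  shows "\<exists>U. unitary U \<and> pauli_dot e = U ** sigma_x ** cadj U \<and> pauli_dot f = U ** sigma_z ** cadj U"
proof -
  obtain v where v: "pauli_dot f *v v = v" and nv: "(cmod (v$0))\<^sup>2 + (cmod (v$1))\<^sup>2 = 1"
    using pauli_dot_eigenvector[OF assms(2)] .
  let ?E = "pauli_dot e" and ?F = "pauli_dot f"
  define w where "w = ?E *v v"
  have EF: "?E ** ?F = - (?F ** ?E)"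
    using pauli_dot_anticommute[of e f] assms by (simp add: eq_neg_iff_add_eq_0)
  have Ew: "?E *v w = v"
    by (simp add: w_def matrix_vector_mul_assoc pauli_dot_square assms)
  have Fw: "?F *v w = - w"
  proof -
    have "?F ** ?E = - (?E ** ?F)" using EF by simp
    then have "?F *v w = (- (?E ** ?F)) *v v" by (simp add: w_def matrix_vector_mul_assoc)
    also have "\<dots> = - (?E *v (?F *v v))"
      by (simp add: matrix_vector_mul_assoc)
         (simp add: matrix_vector_mult_def vec_eq_iff sum_negf)
    finally show ?thesis by (simp add: v w_def)
  qed
  define ip where "ip x y = cnj (x$0) * y$0 + cnj (x$1) * y$1" for x y :: "complex^2"
  have ip: "ip (pauli_dot a *v x) y = ip x (pauli_dot a *v y)" for a x y
    by (simp add: ip_def matrix_vector_mult_def sum_2_01 pauli_dot_entries complex_eq_iff algebra_simps)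
  have ipn: "ip x (- y) = - ip x y" for x y by (simp add: ip_def)
  have ivv: "ip v v = 1" 
    using nv unfolding cmod_power2 by (simp add: ip_def complex_eq_iff power2_eq_square)
  have iww: "ip w w = 1"
    using ip[of e v w] Ew ivv by (simp add: w_def)
  \<comment> \<open>Eigenvectors of a Hermitian matrix for the distinct eigenvalues 1 and
    -1.\<close>
  have ivw: "ip v w = 0"
    using ip[of f v w] by (simp add: v Fw ipn)
  have iwv: "ip w v = 0"
  proof -
    have "ip w v = cnj (ip v w)" by (simp add: ip_def mult.commute)
    then show ?thesis using ivw by simp
  qed
  txt \<open>Since \<open>E\<close> and \<open>F\<close> anticommute, \<open>E\<close> exchanges the two eigenvectors \<open>v\<close>, \<open>w\<close> of \<open>F\<close>.\<close>
  define U :: qop where "U = (\<chi> i j. if j = 0 then v $ i else w $ i)"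
  have U: "U $ i $ 0 = v $ i" "U $ i $ 1 = w $ i" for i by (simp_all add: U_def)
  have uni: "unitary U"
    using ivv iww ivw iwv by (simp add: unitary_def qop_eq_iff qop_mult_nth U mat_1_entries ip_def)
  have X: "?E ** U = U ** sigma_x"
    using Ew w_def by (simp add: qop_eq_iff qop_mult_nth U sigma_entries matrix_vector_mult_def
        vec_eq_iff sum_2_01 forall_2_01)
  have Z: "?F ** U = U ** sigma_z"
    using Fw v by (simp add: qop_eq_iff qop_mult_nth U sigma_entries matrix_vector_mult_def
        vec_eq_iff sum_2_01 forall_2_01)
  have "A = A ** U ** cadj U" for A
    using uni by (simp add: unitary_right flip: matrix_mul_assoc)
  then have "?E = ?E ** U ** cadj U" "?F = ?F ** U ** cadj U" by blast+
  then show ?thesis using uni unfolding X Z by blast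
qed

text \<open>The content lies in the degenerate cases: a zero vector gets some unit direction
  perpendicular to the other one, so vanishing singular values need no separate treatment
  later.\<close>

lemma orthogonal_pair_normalize:
  fixes x y :: "'a::euclidean_space"
  assumes "2 \<le> DIM('a)" "x \<bullet> y = 0"
  obtains e f where "norm e = 1" "norm f = 1" "e \<bullet> f = 0" "x = norm x *\<^sub>R e" "y = norm y *\<^sub>R f"
proof -
  have unit_perp: "\<exists>f. norm f = 1 \<and> e \<bullet> f = 0" for e :: 'a
  proof -
    obtain z where "z \<noteq> 0" "orthogonal e z" using orthogonal_to_vector_exists[OF assms(1)] .
    then show ?thesis by (intro exI[of _ "(1 / norm z) *\<^sub>R z"]) (simp add: orthogonal_def)
  qed
  show ?thesis
  proof (cases "x = 0")
    case True
    show ?thesis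
    proof (cases "y = 0")
      case True
      obtain e :: 'a where e: "norm e = 1" using unit_perp by blast
      obtain f where "norm f = 1" "e \<bullet> f = 0" using unit_perp by blast
      then show ?thesis using e True \<open>x = 0\<close> that by auto
    next
      case False
      obtain e where "norm e = 1" "y \<bullet> e = 0" using unit_perp by blast
      then show ?thesis using False \<open>x = 0\<close>
        by (intro that[of e "(1 / norm y) *\<^sub>R y"]) (auto simp: inner_commute)
    qed
  next
    case False
    show ?thesis
    proof (cases "y = 0")
      case True
      obtain f where "norm f = 1" "x \<bullet> f = 0" using unit_perp by blast
      then show ?thesis using False True
        by (intro that[of "(1 / norm x) *\<^sub>R x" f]) auto
    next
      case False
      then show ?thesis using \<open>x \<noteq> 0\<close> assms
        by (intro that[of "(1 / norm x) *\<^sub>R x" "(1 / norm y) *\<^sub>R y"]) auto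
    qed
  qed
qed

subsection \<open>Diagonal form of CHSH operators\<close>

lemma conj_kron:
  "kron U V ** kron A B ** cadj (kron U V) = kron (U ** A ** cadj U) (V ** B ** cadj V)"
  by (simp add: cadj_kron kron_mult)

lemma conj_add: "W ** (A + B) ** cadj W = W ** A ** cadj W + W ** B ** cadj W"
  for W :: "complex^'n^'n"
  by (simp add: matrix_matrix_mult_def vec_eq_iff sum.distrib algebra_simps)

lemma conj_scaleR: "W ** (r *\<^sub>R A) ** cadj W = r *\<^sub>R (W ** A ** cadj W)"
  for W :: "complex^'n^'n"
  by (simp add: matrix_matrix_mult_def vec_eq_iff scaleR_sum_right sum_distrib_left sum_distrib_right)

lemma conj_diff: "W ** (A - B) ** cadj W = W ** A ** cadj W - W ** B ** cadj W"
  for W :: "complex^'n^'n"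
  by (simp add: matrix_matrix_mult_def vec_eq_iff sum_subtractf algebra_simps)

lemma is_CHSH_unitary_conj:
  assumes "unitary U" "unitary V" "is_CHSH S"
  shows "is_CHSH (kron U V ** S ** cadj (kron U V))"
proof -
  obtain a a' b b' where n: "norm a = 1" "norm a' = 1" "norm b = 1" "norm b' = 1"
    and S: "S = kron (pauli_dot a) (pauli_dot b + pauli_dot b')
       + kron (pauli_dot a') (pauli_dot b - pauli_dot b')"
    using assms(3) by (auto simp: is_CHSH_def)
  obtain c where c: "norm c = 1" "U ** pauli_dot a ** cadj U = pauli_dot c"
    using pauli_dot_unitary_conj[OF assms(1) n(1)] by blast
  obtain c' where c': "norm c' = 1" "U ** pauli_dot a' ** cadj U = pauli_dot c'"
    using pauli_dot_unitary_conj[OF assms(1) n(2)] by blast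
  obtain d where d: "norm d = 1" "V ** pauli_dot b ** cadj V = pauli_dot d"
    using pauli_dot_unitary_conj[OF assms(2) n(3)] by blast
  obtain d' where d': "norm d' = 1" "V ** pauli_dot b' ** cadj V = pauli_dot d'"
    using pauli_dot_unitary_conj[OF assms(2) n(4)] by blast
  have "kron U V ** S ** cadj (kron U V) = kron (pauli_dot c) (pauli_dot d + pauli_dot d')
       + kron (pauli_dot c') (pauli_dot d - pauli_dot d')"
    by (simp add: S conj_add conj_kron conj_diff c c' d d')
  then show ?thesis using c c' d d' unfolding is_CHSH_def by blast
qed

text \<open>The vectors (\<mu>\<open>c\<close> \<plusminus> \<nu>\<open>c'\<close>)/2 have sum
  \<mu>\<open>c\<close> and difference \<nu>\<open>c'\<close>, and orthogonality together with
  \<mu>, \<nu> lying on the circle of radius 2 makes both of them unit vectors.\<close>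

lemma is_CHSH_orthonormal:
  assumes "norm a = 1" "norm a' = 1" "norm c = 1" "norm c' = 1" "c \<bullet> c' = 0" "\<mu>\<^sup>2 + \<nu>\<^sup>2 = 4"
  shows "is_CHSH (\<mu> *\<^sub>R kron (pauli_dot a) (pauli_dot c) + \<nu> *\<^sub>R kron (pauli_dot a') (pauli_dot c'))"
proof -
  define b b' where "b = (\<mu>/2) *\<^sub>R c + (\<nu>/2) *\<^sub>R c'" and "b' = (\<mu>/2) *\<^sub>R c - (\<nu>/2) *\<^sub>R c'"
  have i: "c \<bullet> c = 1" "c' \<bullet> c' = 1" "c' \<bullet> c = 0"
    using assms by (auto simp: norm_eq_1 inner_commute)
  have "b \<bullet> b = (\<mu>\<^sup>2 + \<nu>\<^sup>2) / 4" "b' \<bullet> b' = (\<mu>\<^sup>2 + \<nu>\<^sup>2) / 4"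
    using i assms(5) by (simp_all add: b_def b'_def inner_simps power2_eq_square field_simps)
  then have n: "norm b = 1" "norm b' = 1" using assms(6) by (simp_all add: norm_eq_1)
  have "b + b' = \<mu> *\<^sub>R c" "b - b' = \<nu> *\<^sub>R c'"
    by (simp_all add: b_def b'_def vec_eq_iff)
  then have "pauli_dot b + pauli_dot b' = \<mu> *\<^sub>R pauli_dot c"
    "pauli_dot b - pauli_dot b' = \<nu> *\<^sub>R pauli_dot c'"
    by (simp_all flip: pauli_dot_add pauli_dot_diff add: pauli_dot_scaleR)
  then show ?thesis unfolding is_CHSH_def
    using assms n by (intro exI[of _ a] exI[of _ a'] exI[of _ b] exI[of _ b'])
      (simp add: kron_scaleR_right)
qed

text \<open>One Jacobi rotation. The inner product equals
  \<open>cos (2 * t) * X + sin (2 * t) * Y\<close>, which vanishes when the doubled angle points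
  along (\<open>Y\<close>, -\<open>X\<close>).\<close>

lemma exists_orthogonal_rotation:
  fixes p q :: "'a::real_inner"
  shows "\<exists>t. (cos t *\<^sub>R p + sin t *\<^sub>R q) \<bullet> (cos t *\<^sub>R q - sin t *\<^sub>R p) = 0"
proof -
  define X Y where "X = p \<bullet> q" and "Y = (q \<bullet> q - p \<bullet> p) / 2"
  have "\<exists>t. cos (2 * t) * X + sin (2 * t) * Y = 0"
  proof (cases "X = 0 \<and> Y = 0")
    case False
    define r where "r = sqrt (X\<^sup>2 + Y\<^sup>2)"
    have r: "r > 0" "r\<^sup>2 = X\<^sup>2 + Y\<^sup>2" using False
      by (auto simp: r_def sum_power2_gt_zero_iff)
    have "(Y / r)\<^sup>2 + (- X / r)\<^sup>2 = (X\<^sup>2 + Y\<^sup>2) / r\<^sup>2"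
      by (simp add: power_divide add_divide_distrib)
    also have "\<dots> = 1" unfolding r(2)[symmetric] using r(1) by simp
    finally have "(Y / r)\<^sup>2 + (- X / r)\<^sup>2 = 1" .
    then obtain \<tau> where "Y / r = cos \<tau>" "- X / r = sin \<tau>"
      using sincos_total_2pi by metis
    then have "cos (2 * (\<tau>/2)) * X + sin (2 * (\<tau>/2)) * Y = (Y / r) * X + (- X / r) * Y"
      by simp
    then show ?thesis by (intro exI[of _ "\<tau>/2"]) simp
  qed simp
  then obtain t where t: "cos (2 * t) * X + sin (2 * t) * Y = 0" ..
  have "(cos t *\<^sub>R p + sin t *\<^sub>R q) \<bullet> (cos t *\<^sub>R q - sin t *\<^sub>R p)
      = cos (2 * t) * X + sin (2 * t) * Y"
    by (simp add: X_def Y_def inner_simps cos_double sin_double power2_eq_square inner_commute[of q p])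
       (simp add: algebra_simps)
  then show ?thesis using t by metis
qed

text \<open>The coefficient matrix is a sum of two dyads, \<open>p\<close> with \<open>c\<close> and
  \<open>q\<close> with \<open>c'\<close>, where \<open>c\<close> and \<open>c'\<close> are already
  orthonormal. A rotation makes the left factors orthogonal too, and their lengths are then the
  singular values.\<close>

lemma CHSH_diagonal_form:
  assumes "is_CHSH S"
  obtains U V \<alpha> \<gamma> where "unitary U" "unitary V" "0 \<le> \<alpha>" "\<alpha> \<le> \<gamma>" "\<alpha>\<^sup>2 + \<gamma>\<^sup>2 = 4"
    "S = kron U V ** (\<alpha> *\<^sub>R kron sigma_x sigma_x + \<gamma> *\<^sub>R kron sigma_z sigma_z) ** cadj (kron U V)"
proof -
  let ?K = "\<lambda>a b. kron (pauli_dot a) (pauli_dot b)"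
  obtain a a' b b' where n: "norm a = 1" "norm a' = 1" "norm b = 1" "norm b' = 1"
    and S: "S = kron (pauli_dot a) (pauli_dot b + pauli_dot b')
       + kron (pauli_dot a') (pauli_dot b - pauli_dot b')"
    using assms by (auto simp: is_CHSH_def)
  have dim: "2 \<le> DIM(real^3)" unfolding DIM_cart by simp
  have i: "b \<bullet> b = 1" "b' \<bullet> b' = 1" using n by (auto simp: norm_eq_1)
  \<comment> \<open>The diagonals of a rhombus are perpendicular.\<close>
  then have "(b + b') \<bullet> (b - b') = 0" by (simp add: inner_simps inner_commute)
  then obtain c c' where c: "norm c = 1" "norm c' = 1" "c \<bullet> c' = 0"
    "b + b' = norm (b + b') *\<^sub>R c" "b - b' = norm (b - b') *\<^sub>R c'"
    by (rule orthogonal_pair_normalize[OF dim])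
  have ci: "c \<bullet> c = 1" "c' \<bullet> c' = 1" "c' \<bullet> c = 0"
    using c by (auto simp: norm_eq_1 inner_commute)
  define p q where "p = norm (b + b') *\<^sub>R a" and "q = norm (b - b') *\<^sub>R a'"
  \<comment> \<open>The squared Frobenius norm of the coefficient matrix, by the parallelogram
    law.\<close>
  have pq: "p \<bullet> p + q \<bullet> q = 4"
  proof -
    have "a \<bullet> a = 1" "a' \<bullet> a' = 1" using n by (auto simp: norm_eq_1)
    then have "p \<bullet> p = (b + b') \<bullet> (b + b')" "q \<bullet> q = (b - b') \<bullet> (b - b')"
      by (simp_all add: p_def q_def power2_norm_eq_inner[symmetric] power2_eq_square)
    moreover have "(b + b') \<bullet> (b + b') + (b - b') \<bullet> (b - b') = 2 * (b \<bullet> b) + 2 * (b' \<bullet> b')"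
      by (simp add: inner_simps)
    ultimately show ?thesis using i by simp
  qed
  have S1: "S = ?K p c + ?K q c'"
  proof -
    have "pauli_dot b + pauli_dot b' = norm (b + b') *\<^sub>R pauli_dot c"
      using arg_cong[OF c(4), of pauli_dot] by (simp only: pauli_dot_add pauli_dot_scaleR)
    moreover have "pauli_dot b - pauli_dot b' = norm (b - b') *\<^sub>R pauli_dot c'"
      using arg_cong[OF c(5), of pauli_dot] by (simp only: pauli_dot_diff pauli_dot_scaleR)
    ultimately show ?thesis
      by (simp add: S p_def q_def pauli_dot_scaleR kron_scaleR_left kron_scaleR_right)
  qed
  obtain t where t: "(cos t *\<^sub>R p + sin t *\<^sub>R q) \<bullet> (cos t *\<^sub>R q - sin t *\<^sub>R p) = 0"
    using exists_orthogonal_rotation by blast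
  define p1 q1 where "p1 = cos t *\<^sub>R p + sin t *\<^sub>R q" and "q1 = cos t *\<^sub>R q - sin t *\<^sub>R p"
  define c1 c1' where "c1 = cos t *\<^sub>R c + sin t *\<^sub>R c'" and "c1' = cos t *\<^sub>R c' - sin t *\<^sub>R c"
  have sc: "sin t * sin t + cos t * cos t = 1"
    using sin_cos_squared_add[of t] by (simp add: power2_eq_square)
  have c1: "norm c1 = 1" "norm c1' = 1" "c1 \<bullet> c1' = 0"
    using ci c(3) sc by (simp_all add: c1_def c1'_def norm_eq_1 inner_simps algebra_simps)
  have pq1: "p1 \<bullet> p1 + q1 \<bullet> q1 = 4"
  proof -
    have "p1 \<bullet> p1 + q1 \<bullet> q1 = sin t * sin t * (p \<bullet> p + q \<bullet> q) + cos t * cos t * (p \<bullet> p + q \<bullet> q)"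
      by (simp add: p1_def q1_def inner_simps algebra_simps inner_commute)
    then show ?thesis using sc pq by (simp flip: distrib_right)
  qed
  \<comment> \<open>Rotating both pairs by the same angle leaves the sum of dyads unchanged, since
    the cross terms cancel.\<close>
  have S2: "S = ?K p1 c1 + ?K q1 c1'"
  proof -
    have "?K p1 c1 + ?K q1 c1' = (sin t * sin t) *\<^sub>R (?K p c + ?K q c') + (cos t * cos t) *\<^sub>R (?K p c + ?K q c')"
      by (simp add: p1_def q1_def c1_def c1'_def pauli_dot_add pauli_dot_diff pauli_dot_scaleR
          kron_def vec_eq_iff) (simp add: scaleR_conv_of_real algebra_simps)
    then show ?thesis using sc S1 by (simp flip: scaleR_add_left)
  qed
  have "p1 \<bullet> q1 = 0" using t by (simp add: p1_def q1_def)
  then obtain e f where e: "norm e = 1" "norm f = 1" "e \<bullet> f = 0"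
    "p1 = norm p1 *\<^sub>R e" "q1 = norm q1 *\<^sub>R f"
    by (rule orthogonal_pair_normalize[OF dim])
  have S3: "S = norm p1 *\<^sub>R ?K e c1 + norm q1 *\<^sub>R ?K f c1'"
  proof -
    have "pauli_dot p1 = norm p1 *\<^sub>R pauli_dot e" "pauli_dot q1 = norm q1 *\<^sub>R pauli_dot f"
      using arg_cong[OF e(4), of pauli_dot] arg_cong[OF e(5), of pauli_dot]
      by (simp_all only: pauli_dot_scaleR)
    then show ?thesis by (simp only: S2 kron_scaleR_left)
  qed
  have N: "(norm p1)\<^sup>2 + (norm q1)\<^sup>2 = 4" using pq1 by (simp add: power2_norm_eq_inner)
  have conj: "\<exists>U V. unitary U \<and> unitary V \<and>
      x *\<^sub>R ?K e' d + y *\<^sub>R ?K f' d' =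
      kron U V ** (x *\<^sub>R kron sigma_x sigma_x + y *\<^sub>R kron sigma_z sigma_z) ** cadj (kron U V)"
    if ef: "norm e' = 1" "norm f' = 1" "e' \<bullet> f' = 0" and dd: "norm d = 1" "norm d' = 1" "d \<bullet> d' = 0"
    for x y e' f' d d'
  proof -
    obtain U where U: "unitary U" "pauli_dot e' = U ** sigma_x ** cadj U" "pauli_dot f' = U ** sigma_z ** cadj U"
      using orthonormal_pauli_conj[OF ef] by blast
    obtain V where V: "unitary V" "pauli_dot d = V ** sigma_x ** cadj V" "pauli_dot d' = V ** sigma_z ** cadj V"
      using orthonormal_pauli_conj[OF dd] by blast
    have "x *\<^sub>R ?K e' d + y *\<^sub>R ?K f' d' =
      kron U V ** (x *\<^sub>R kron sigma_x sigma_x + y *\<^sub>R kron sigma_z sigma_z) ** cadj (kron U V)"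
      unfolding conj_add conj_scaleR conj_kron U(2,3) V(2,3) ..
    then show ?thesis using U(1) V(1) by blast
  qed
  \<comment> \<open>The larger singular value must go with \<open>sigma_z\<close>; in the second
    case the two axes are exchanged.\<close>
  show ?thesis
  proof (cases "norm p1 \<le> norm q1")
    case True
    then show ?thesis
      using conj[OF e(1-3) c1, of "norm p1" "norm q1"] S3 N that norm_ge_zero by metis
  next
    case False
    have "S = norm q1 *\<^sub>R ?K f c1' + norm p1 *\<^sub>R ?K e c1" by (simp add: S3 add.commute)
    moreover have "f \<bullet> e = 0" "c1' \<bullet> c1 = 0" using e c1 by (simp_all add: inner_commute)
    moreover have "(norm q1)\<^sup>2 + (norm p1)\<^sup>2 = 4" using N by simp
    ultimately show ?thesis
      using conj[OF e(2,1) _ c1(2,1), of "norm q1" "norm p1"] False that[of _ _ "norm q1" "norm p1"]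
      by (metis linear norm_ge_zero)
  qed
qed

subsection \<open>Concurrence and Schmidt decomposition\<close>

text \<open>Inside the modulus stands the determinant of the 2 by 2 matrix of amplitudes.\<close>

definition concurrence :: "qqvec \<Rightarrow> real" where
  "concurrence \<psi> = 2 * cmod (\<psi>$(0,0) * \<psi>$(1,1) - \<psi>$(0,1) * \<psi>$(1,0))"

lemma kron_mult_vec_nth:
  "(kron U V *v \<psi>) $ (i,j) = U$i$0 * V$j$0 * \<psi>$(0,0) + U$i$0 * V$j$1 * \<psi>$(0,1)
     + U$i$1 * V$j$0 * \<psi>$(1,0) + U$i$1 * V$j$1 * \<psi>$(1,1)"
  by (simp add: matrix_vector_mult_def kron_def sum_22)

text \<open>A local unitary multiplies the amplitude matrix by \<open>U\<close> on the left and by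
  the transpose of \<open>V\<close> on the right; determinants multiply, and those of unitaries have
  modulus 1.\<close>

lemma concurrence_unitary:
  assumes "unitary U" "unitary V"
  shows "concurrence (kron U V *v \<psi>) = concurrence \<psi>"
proof -
  define d where "d A = A$0$0 * A$1$1 - A$0$1 * A$1$0" for A :: qop
  have d1: "cmod (d W) = 1" if "unitary W" for W
  proof -
    have "d (cadj W ** W) = cnj (d W) * d W"
      by (simp add: d_def qop_mult_nth algebra_simps)
    moreover have "d (mat 1) = 1" by (simp add: d_def mat_1_entries)
    ultimately have "cnj (d W) * d W = 1" using that by (simp add: unitary_def)
    then have "cmod (cnj (d W) * d W) = 1" by simp
    then have "(cmod (d W))\<^sup>2 = 1" by (simp only: norm_mult complex_mod_cnj power2_eq_square)
    then show ?thesis by (simp add: power2_eq_1_iff) (smt (verit) norm_ge_zero)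
  qed
  define \<phi> where "\<phi> = kron U V *v \<psi>"
  have "\<phi>$(0,0) * \<phi>$(1,1) - \<phi>$(0,1) * \<phi>$(1,0)
     = d U * d V * (\<psi>$(0,0) * \<psi>$(1,1) - \<psi>$(0,1) * \<psi>$(1,0))"
    by (simp add: \<phi>_def kron_mult_vec_nth d_def algebra_simps)
  then show ?thesis
    unfolding concurrence_def \<phi>_def[symmetric] by (simp add: norm_mult d1 assms)
qed

lemma qqvec_eq_iff:
  "(\<psi> :: qqvec) = \<phi> \<longleftrightarrow> \<psi>$(0,0) = \<phi>$(0,0) \<and> \<psi>$(0,1) = \<phi>$(0,1) \<and> \<psi>$(1,0) = \<phi>$(1,0) \<and> \<psi>$(1,1) = \<phi>$(1,1)"
  by (simp add: vec_eq_iff split_paired_All forall_2_01)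

lemma ket_entries:
  "ket 0 0 $ (0,0) = 1" "ket 0 0 $ (0,1) = 0" "ket 0 0 $ (1,0) = 0" "ket 0 0 $ (1,1) = 0"
  "ket 1 1 $ (0,0) = 0" "ket 1 1 $ (0,1) = 0" "ket 1 1 $ (1,0) = 0" "ket 1 1 $ (1,1) = 1"
  by (simp_all add: ket_def axis_def)

lemma norm_qqvec:
  "(norm (\<psi> :: qqvec))\<^sup>2 = (cmod (\<psi>$(0,0)))\<^sup>2 + (cmod (\<psi>$(0,1)))\<^sup>2 + (cmod (\<psi>$(1,0)))\<^sup>2 + (cmod (\<psi>$(1,1)))\<^sup>2"
  by (simp add: norm_vec_def L2_set_def sum_22)

section \<open>Polar and Schmidt decompositions\<close>

lemma complex_phase_exists: "\<exists>c. cmod c = 1 \<and> z = c * of_real (cmod z)"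
proof (cases "z = 0")
  case True
  then show ?thesis by (intro exI[of _ 1]) simp
next
  case False
  then have "cmod (sgn z) = 1" by (simp add: norm_sgn)
  moreover have "z = sgn z * of_real (cmod z)"
    using False by (simp add: sgn_div_norm scaleR_conv_of_real field_simps)
  ultimately show ?thesis by blast
qed

lemma polar_C2:
  fixes x y :: complex
  shows "\<exists>r u v. 0 \<le> r \<and> u * cnj u + v * cnj v = 1 \<and> x = of_real r * u \<and> y = of_real r * v"
proof (cases "x = 0 \<and> y = 0")
  case True
  then show ?thesis by (intro exI[of _ 0] exI[of _ 1] exI[of _ 0]) simp
next
  case False
  define r where "r = sqrt ((cmod x)\<^sup>2 + (cmod y)\<^sup>2)"
  have "0 < (cmod x)\<^sup>2 + (cmod y)\<^sup>2" using False by (simp add: sum_power2_gt_zero_iff)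
  then have r: "r > 0" "r\<^sup>2 = (cmod x)\<^sup>2 + (cmod y)\<^sup>2" by (simp_all add: r_def)
  have "x * cnj x + y * cnj y = complex_of_real (r\<^sup>2)"
    by (simp only: r(2) of_real_add complex_norm_square)
  then have "(x / of_real r) * cnj (x / of_real r) + (y / of_real r) * cnj (y / of_real r) = 1"
    using r(1) by (simp add: power2_eq_square flip: add_divide_distrib)
  then show ?thesis using r(1)
    by (intro exI[of _ r] exI[of _ "x / of_real r"] exI[of _ "y / of_real r"]) simp
qed

text \<open>The orthogonal complement of (\<open>u\<close>, \<open>v\<close>) is spanned by
  (-\<open>cnj v\<close>, \<open>cnj u\<close>). The free phase \<omega> can absorb the phase of a
  coefficient that should become nonnegative.\<close>

lemma unitary_of_columns:
  assumes "u * cnj u + v * cnj v = 1" "cmod \<omega> = 1"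
  obtains V :: qop where "unitary V" "V$0$0 = u" "V$1$0 = v" "V$0$1 = - \<omega> * cnj v" "V$1$1 = \<omega> * cnj u"
proof -
  define V :: qop where "V = (\<chi> i j. if j = 0 then (if i = 0 then u else v)
     else (if i = 0 then - \<omega> * cnj v else \<omega> * cnj u))"
  have V: "V$0$0 = u" "V$1$0 = v" "V$0$1 = - \<omega> * cnj v" "V$1$1 = \<omega> * cnj u"
    by (simp_all add: V_def)
  have w: "\<omega> * cnj \<omega> = 1" using assms(2) by (metis complex_norm_square of_real_1 power_one)
  have "v * cnj \<omega> * (\<omega> * cnj v) + u * cnj \<omega> * (\<omega> * cnj u) = \<omega> * cnj \<omega> * (u * cnj u + v * cnj v)"
    by (simp add: algebra_simps)
  then have "unitary V"
    using assms(1) w by (simp add: unitary_def qop_eq_iff qop_mult_nth V mat_1_entries algebra_simps)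
  then show ?thesis using V that by blast
qed

text \<open>The row lengths become \<open>r\<close> and \<open>s\<close>, and the normalized rows
  become the columns of \<open>V\<close>.\<close>

lemma orthogonal_rows:
  fixes W :: qop
  assumes "W$0$0 * cnj (W$1$0) + W$0$1 * cnj (W$1$1) = 0"
  obtains V r s where "unitary V" "0 \<le> r" "0 \<le> s" 
    "\<forall>j. W$0$j = of_real r * V$j$0" "\<forall>j. W$1$j = of_real s * V$j$1"
proof (cases "W$0$0 = 0 \<and> W$0$1 = 0")
  case True
  obtain s u v where s: "0 \<le> s" "u * cnj u + v * cnj v = 1" "W$1$0 = of_real s * u" "W$1$1 = of_real s * v"
    using polar_C2[of "W$1$0" "W$1$1"] by blast
  \<comment> \<open>Only the second row carries information, so the first column is chosen such that
    its complement with phase 1 is exactly (\<open>u\<close>, \<open>v\<close>).\<close>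
  have "cnj v * cnj (cnj v) + (- cnj u) * cnj (- cnj u) = 1" using s(2) by (simp add: algebra_simps)
  then obtain V :: qop where "unitary V" "V$0$0 = cnj v" "V$1$0 = - cnj u" "V$0$1 = - 1 * cnj (- cnj u)" "V$1$1 = 1 * cnj (cnj v)"
    using unitary_of_columns[of "cnj v" "- cnj u" 1] by auto
  then have "unitary V" "\<forall>j. W$0$j = of_real 0 * V$j$0" "\<forall>j. W$1$j = of_real s * V$j$1"
    using True s by (simp_all add: forall_2_01)
  then show ?thesis using that s(1) by blast
next
  case False
  obtain r u v where r: "0 \<le> r" "u * cnj u + v * cnj v = 1" "W$0$0 = of_real r * u" "W$0$1 = of_real r * v"
    using polar_C2[of "W$0$0" "W$0$1"] by blast
  have "r \<noteq> 0" using False r by auto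
  have "of_real r * (u * cnj (W$1$0) + v * cnj (W$1$1)) = 0"
    using assms r(3,4) by (simp add: algebra_simps)
  then have "u * cnj (W$1$0) + v * cnj (W$1$1) = 0" using \<open>r \<noteq> 0\<close> by simp
  then have "cnj (u * cnj (W$1$0) + v * cnj (W$1$1)) = 0" by simp
  then have o: "cnj u * W$1$0 + cnj v * W$1$1 = 0" by simp
  \<comment> \<open>The coordinate of the second row along (-\<open>cnj v\<close>,
    \<open>cnj u\<close>); its modulus becomes \<open>s\<close> and its phase becomes
    \<omega>.\<close>
  define \<kappa> where "\<kappa> = u * W$1$1 - v * W$1$0"
  have "W$1$0 = (u * cnj u + v * cnj v) * W$1$0 - u * (cnj u * W$1$0 + cnj v * W$1$1)"
    using o r(2) by simp
  then have k0: "W$1$0 = - \<kappa> * cnj v" unfolding \<kappa>_def by (simp add: algebra_simps)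
  have "W$1$1 = (u * cnj u + v * cnj v) * W$1$1 - v * (cnj u * W$1$0 + cnj v * W$1$1)"
    using o r(2) by simp
  then have k1: "W$1$1 = \<kappa> * cnj u" unfolding \<kappa>_def by (simp add: algebra_simps)
  obtain \<omega> where w: "cmod \<omega> = 1" "\<kappa> = \<omega> * of_real (cmod \<kappa>)"
    using complex_phase_exists by blast
  obtain V :: qop where V: "unitary V" "V$0$0 = u" "V$1$0 = v" "V$0$1 = - \<omega> * cnj v" "V$1$1 = \<omega> * cnj u"
    using unitary_of_columns[OF r(2) w(1)] .
  have "W$1$0 = - (\<omega> * of_real (cmod \<kappa>)) * cnj v" "W$1$1 = \<omega> * of_real (cmod \<kappa>) * cnj u"
    using k0 k1 w(2) by auto
  then have "W$1$0 = of_real (cmod \<kappa>) * V$0$1" "W$1$1 = of_real (cmod \<kappa>) * V$1$1"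
    by (simp_all add: V)
  then have "\<forall>j. W$0$j = of_real r * V$j$0" "\<forall>j. W$1$j = of_real (cmod \<kappa>) * V$j$1"
    using r V by (simp_all add: forall_2_01)
  then show ?thesis using that[OF V(1) r(1) norm_ge_zero[of \<kappa>]] by blast
qed

text \<open>With \<open>P\<close> the amplitude matrix, \<open>U\<close> diagonalizes
  \<open>P ** cadj P\<close>. Then the rows of \<open>cadj U ** P\<close> are orthogonal, and
  \<open>orthogonal_rows\<close> supplies the other unitary.\<close>

lemma schmidt_decomposition:
  fixes \<psi> :: qqvec
  obtains U V r s where "unitary U" "unitary V" "0 \<le> r" "0 \<le> s"
    "\<psi> = kron U V *v (complex_of_real r *s ket 0 0 + complex_of_real s *s ket 1 1)"
proof -
  define P :: qop where "P = (\<chi> i j. \<psi> $ (i,j))"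
  define H where "H = P ** cadj P"
  \<comment> \<open>Half the trace: subtracting it leaves a traceless Hermitian matrix, hence a
    Bloch vector \<open>h\<close>, whose direction determines the eigenbasis.\<close>
  define \<tau> where "\<tau> = Re (H$0$0 + H$1$1) / 2"
  have Hh: "cadj H = H" by (simp add: H_def cadj_mult)
  have Hc: "H $ i $ j = cnj (H $ j $ i)" for i j by (subst Hh[symmetric]) simp
  have Im0: "Im (H$i$i) = 0" for i using arg_cong[OF Hc[of i i], of Im] by simp
  have "cadj (H - \<tau> *\<^sub>R mat 1) = H - \<tau> *\<^sub>R mat 1"
    by (simp add: qop_eq_iff mat_1_entries flip: Hc)
  moreover have "(H - \<tau> *\<^sub>R mat 1) $ 0 $ 0 + (H - \<tau> *\<^sub>R mat 1) $ 1 $ 1 = 0"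
    using Im0 by (simp add: mat_1_entries \<tau>_def complex_eq_iff)
  ultimately obtain h where h: "H - \<tau> *\<^sub>R mat 1 = pauli_dot h" using pauli_dot_exists by blast
  have dim: "2 \<le> DIM(real^3)" unfolding DIM_cart by simp
  \<comment> \<open>Pairing \<open>h\<close> with the zero vector yields a direction of
    \<open>h\<close> and a perpendicular companion, even when \<open>h\<close> is zero.\<close>
  obtain e f where ef: "norm e = 1" "norm f = 1" "e \<bullet> f = 0" "h = norm h *\<^sub>R f"
    using orthogonal_pair_normalize[OF dim, of 0 h] by (metis inner_zero_left)
  obtain U where U: "unitary U" "pauli_dot f = U ** sigma_z ** cadj U"
    using orthonormal_pauli_conj[OF ef(1-3)] by blast
  define W where "W = cadj U ** P"
  have "pauli_dot h = norm h *\<^sub>R pauli_dot f"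
    using arg_cong[OF ef(4), of pauli_dot] by (simp only: pauli_dot_scaleR)
  then have "H = \<tau> *\<^sub>R mat 1 + norm h *\<^sub>R (U ** sigma_z ** cadj U)"
    using h U(2) by (simp add: algebra_simps)
  then have "cadj U ** H ** cadj (cadj U) = \<tau> *\<^sub>R mat 1 + norm h *\<^sub>R (cadj U ** (U ** sigma_z ** cadj U) ** U)"
    using U(1) by (simp only: conj_add conj_scaleR) (simp add: unitary_def)
  also have "cadj U ** (U ** sigma_z ** cadj U) ** U = sigma_z"
  proof -
    have "cadj U ** (U ** sigma_z ** cadj U) ** U = cadj U ** (U ** (sigma_z ** (cadj U ** U)))"
      by (simp add: matrix_mul_assoc)
    then show ?thesis using U(1) by (simp add: unitary_conj_cancel) (simp add: unitary_def)
  qed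
  finally have "W ** cadj W = \<tau> *\<^sub>R mat 1 + norm h *\<^sub>R sigma_z"
    by (simp add: W_def H_def cadj_mult matrix_mul_assoc)
  then have "(W ** cadj W) $ 0 $ 1 = 0" by (simp add: mat_1_entries sigma_entries)
  then have "W$0$0 * cnj (W$1$0) + W$0$1 * cnj (W$1$1) = 0" by (simp add: qop_mult_nth)
  then obtain V r s where V: "unitary V" "0 \<le> r" "0 \<le> s" 
    "\<forall>j. W$0$j = of_real r * V$j$0" "\<forall>j. W$1$j = of_real s * V$j$1"
    by (rule orthogonal_rows)
  have "P = U ** W" using U(1) by (simp add: W_def matrix_mul_assoc unitary_right)
  then have "\<psi> $ (i,j) = U$i$0 * W$0$j + U$i$1 * W$1$j" for i j
    by (metis (no_types, lifting) P_def qop_mult_nth vec_lambda_beta)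
  then have "\<psi> = kron U V *v (complex_of_real r *s ket 0 0 + complex_of_real s *s ket 1 1)"
    by (simp add: qqvec_eq_iff kron_mult_vec_nth ket_entries V(4,5))
  then show ?thesis using that U(1) V by blast
qed

subsection \<open>The maximal CHSH value of a pure state\<close>

lemma chsh_value_linear:
  "chsh_value (dens \<psi>) (r *\<^sub>R S + t *\<^sub>R T) = r * chsh_value (dens \<psi>) S + t * chsh_value (dens \<psi>) T"
  by (simp add: chsh_value_def trace_def matrix_matrix_mult_def sum_22 algebra_simps)

lemma chsh_value_xx:
  "chsh_value (dens \<psi>) (kron sigma_x sigma_x) = 2 * Re (cnj (\<psi>$(0,0)) * \<psi>$(1,1) + cnj (\<psi>$(0,1)) * \<psi>$(1,0))"
  by (simp add: chsh_value_def trace_def matrix_matrix_mult_def sum_22 kron_def dens_def sigma_entries)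

lemma chsh_value_yy:
  "chsh_value (dens \<psi>) (kron sigma_y sigma_y) = 2 * Re (cnj (\<psi>$(0,1)) * \<psi>$(1,0) - cnj (\<psi>$(0,0)) * \<psi>$(1,1))"
  by (simp add: chsh_value_def trace_def matrix_matrix_mult_def sum_22 kron_def dens_def sigma_entries)

lemma chsh_value_zz:
  "chsh_value (dens \<psi>) (kron sigma_z sigma_z) =
     (cmod (\<psi>$(0,0)))\<^sup>2 + (cmod (\<psi>$(1,1)))\<^sup>2 - (cmod (\<psi>$(0,1)))\<^sup>2 - (cmod (\<psi>$(1,0)))\<^sup>2"
  unfolding cmod_power2
  by (simp add: chsh_value_def trace_def matrix_matrix_mult_def sum_22 kron_def dens_def sigma_entries
      power2_eq_square)

text \<open>The second claim prepares the equality case of the CHSH bound. Its side conditions on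
  \<open>A\<close> and \<open>B\<close> are what \<alpha> \<le> \<gamma> provides there.\<close>

lemma correlations_bound:
  fixes \<psi> :: qqvec
  assumes "norm \<psi> = 1"
  defines "A \<equiv> chsh_value (dens \<psi>) (kron sigma_z sigma_z)"
    and "B \<equiv> chsh_value (dens \<psi>) (kron sigma_x sigma_x)"
    and "C \<equiv> concurrence \<psi>"
  shows "A\<^sup>2 + B\<^sup>2 \<le> 1 + C\<^sup>2"
    and "\<lbrakk>A\<^sup>2 + B\<^sup>2 = 1 + C\<^sup>2; \<bar>B\<bar> \<le> \<bar>A\<bar>; 0 < A\<rbrakk> \<Longrightarrow> \<psi>$(0,1) = 0 \<and> \<psi>$(1,0) = 0"
proof -
  define q where "q = (cmod (\<psi>$(0,1)))\<^sup>2 + (cmod (\<psi>$(1,0)))\<^sup>2"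
  define x where "x = 2 * (cmod (\<psi>$(0,0)) * cmod (\<psi>$(1,1)))"
  define y where "y = 2 * (cmod (\<psi>$(0,1)) * cmod (\<psi>$(1,0)))"
  have n: "(cmod (\<psi>$(0,0)))\<^sup>2 + (cmod (\<psi>$(1,1)))\<^sup>2 = 1 - q"
    using norm_qqvec[of \<psi>] assms(1) by (simp add: q_def)
  have A: "A = 1 - 2 * q" using n by (simp add: A_def chsh_value_zz q_def)
  have am: "2 * (u * v) \<le> u\<^sup>2 + v\<^sup>2" for u v :: real
    using sum_squares_bound[of u v] by (simp add: mult.assoc)
  have x: "0 \<le> x" "x \<le> 1 - q" using am n by (auto simp: x_def simp flip: n)
  have y: "0 \<le> y" "y \<le> q" using am by (auto simp: y_def q_def)
  have B: "\<bar>B\<bar> \<le> x + y"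
  proof -
    define z where "z = cnj (\<psi>$(0,0)) * \<psi>$(1,1) + cnj (\<psi>$(0,1)) * \<psi>$(1,0)"
    have "cmod z \<le> cmod (cnj (\<psi>$(0,0)) * \<psi>$(1,1)) + cmod (cnj (\<psi>$(0,1)) * \<psi>$(1,0))"
      unfolding z_def by (rule norm_triangle_ineq)
    then have "2 * cmod z \<le> x + y" by (simp add: x_def y_def norm_mult)
    moreover have "B = 2 * Re z" by (simp only: B_def chsh_value_xx z_def)
    ultimately show ?thesis using abs_Re_le_cmod[of z] by linarith
  qed
  have C: "\<bar>x - y\<bar> \<le> C"
  proof -
    have "\<bar>cmod (\<psi>$(0,0) * \<psi>$(1,1)) - cmod (\<psi>$(0,1) * \<psi>$(1,0))\<bar>
      \<le> cmod (\<psi>$(0,0) * \<psi>$(1,1) - \<psi>$(0,1) * \<psi>$(1,0))" by (rule norm_triangle_ineq3)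
    then show ?thesis by (simp add: C_def concurrence_def x_def y_def norm_mult)
  qed
  have B2: "B\<^sup>2 \<le> (x + y)\<^sup>2" using B by (metis abs_le_square_iff abs_of_nonneg add_nonneg_nonneg x(1) y(1))
  have C2: "(x - y)\<^sup>2 \<le> C\<^sup>2" using C by (metis abs_ge_zero order_trans abs_le_square_iff abs_of_nonneg)
  have xy: "x * y \<le> (1 - q) * q" using x y by (intro mult_mono) auto
  have id: "A\<^sup>2 + (x + y)\<^sup>2 = 1 + (x - y)\<^sup>2 - 4 * ((1 - q) * q - x * y)"
    by (simp add: A power2_eq_square algebra_simps)
  \<comment> \<open>The bound is a sum of three slacks, so equality in it forces each of them to
    vanish.\<close>
  have lin: "a + b \<le> 1 + c \<and> (a + b = 1 + c \<longrightarrow> p = m \<and> b = u)"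
    if "b \<le> u" "v \<le> c" "p \<le> m" "a + u = 1 + v - 4 * (m - p)" for a b c u v p m :: real
    using that by argo
  show "A\<^sup>2 + B\<^sup>2 \<le> 1 + C\<^sup>2" using lin[OF B2 C2 xy id] by blast
  assume eq: "A\<^sup>2 + B\<^sup>2 = 1 + C\<^sup>2" and BA: "\<bar>B\<bar> \<le> \<bar>A\<bar>" and "0 < A"
  have exy: "x * y = (1 - q) * q" and eB: "B\<^sup>2 = (x + y)\<^sup>2" using lin[OF B2 C2 xy id] eq by blast+
  have eB': "\<bar>B\<bar> = x + y" using eB x y by (metis abs_of_nonneg add_nonneg_nonneg power2_eq_iff_nonneg abs_ge_zero power2_abs)
  \<comment> \<open>If \<open>q\<close> were positive, tightness of \<open>x * y\<close> would push
    \<open>x\<close> up to 1 - \<open>q\<close> and \<open>y\<close> up to \<open>q\<close>. Then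
    \<bar>\<open>B\<close>\<bar> would be at least 1, while \<open>A\<close> = 1 - 2\<open>q\<close>
    is below 1.\<close>
  have "q = 0"
  proof (rule ccontr)
    assume "q \<noteq> 0"
    with y have q: "q > 0" by linarith
    have q1: "1 - q > 0" using \<open>0 < A\<close> A q by linarith
    have "(1 - q) * q \<le> x * q" using exy x y by (metis mult_left_mono)
    then have "1 - q \<le> x" using q by simp
    moreover have "(1 - q) * q \<le> (1 - q) * y" using exy x y by (metis mult_right_mono)
    then have "q \<le> y" using q1 by simp
    ultimately have "\<bar>B\<bar> \<ge> 1" using eB' by linarith
    then show False using BA A \<open>0 < A\<close> q by linarith
  qed
  then show "\<psi>$(0,1) = 0 \<and> \<psi>$(1,0) = 0" by (simp add: q_def sum_power2_eq_zero_iff)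
qed

text \<open>Cauchy-Schwarz in the form of Lagrange's identity, whose second square measures the
  failure of equality.\<close>

lemma diagonal_value_le:
  assumes "norm \<psi> = 1" "\<alpha>\<^sup>2 + \<gamma>\<^sup>2 = 4"
  shows "chsh_value (dens \<psi>) (\<alpha> *\<^sub>R kron sigma_x sigma_x + \<gamma> *\<^sub>R kron sigma_z sigma_z)
    \<le> 2 * sqrt (1 + (concurrence \<psi>)\<^sup>2)"
proof -
  define A where "A = chsh_value (dens \<psi>) (kron sigma_z sigma_z)"
  define B where "B = chsh_value (dens \<psi>) (kron sigma_x sigma_x)"
  have "(\<alpha> * B + \<gamma> * A)\<^sup>2 + (\<gamma> * B - \<alpha> * A)\<^sup>2 = (\<alpha>\<^sup>2 + \<gamma>\<^sup>2) * (A\<^sup>2 + B\<^sup>2)"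
    by (simp add: power2_eq_square algebra_simps)
  moreover have "(\<alpha> * B + \<gamma> * A)\<^sup>2 \<le> (\<alpha> * B + \<gamma> * A)\<^sup>2 + (\<gamma> * B - \<alpha> * A)\<^sup>2" by simp
  ultimately have "(\<alpha> * B + \<gamma> * A)\<^sup>2 \<le> 4 * (A\<^sup>2 + B\<^sup>2)" by (simp only: assms(2))
  also have "\<dots> \<le> 4 * (1 + (concurrence \<psi>)\<^sup>2)"
    using correlations_bound(1)[OF assms(1)] by (simp add: A_def B_def)
  finally have "\<alpha> * B + \<gamma> * A \<le> sqrt (4 * (1 + (concurrence \<psi>)\<^sup>2))" by (rule real_le_rsqrt)
  then show ?thesis by (simp only: real_sqrt_mult real_sqrt_four chsh_value_linear A_def B_def)
qed

text \<open>Equality makes the Lagrange square vanish, so (\<open>B\<close>, \<open>A\<close>) is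
  parallel to (\<alpha>, \<gamma>), and it makes \<open>correlations_bound\<close> tight, so only
  the amplitudes of |00> and |11> survive.\<close>

lemma diagonal_value_eq:
  assumes "norm \<psi> = 1" "0 \<le> \<alpha>" "\<alpha> \<le> \<gamma>" "\<alpha>\<^sup>2 + \<gamma>\<^sup>2 = 4"
    and eq: "chsh_value (dens \<psi>) (\<alpha> *\<^sub>R kron sigma_x sigma_x + \<gamma> *\<^sub>R kron sigma_z sigma_z)
      = 2 * sqrt (1 + (concurrence \<psi>)\<^sup>2)"
  obtains r s where "0 \<le> r" "0 \<le> s" "r\<^sup>2 + s\<^sup>2 = 1" "\<gamma> * (2 * r * s) = \<alpha>"
    "same_state \<psi> (complex_of_real r *s ket 0 0 + complex_of_real s *s ket 1 1)"
proof -
  define A where "A = chsh_value (dens \<psi>) (kron sigma_z sigma_z)"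
  define B where "B = chsh_value (dens \<psi>) (kron sigma_x sigma_x)"
  define C where "C = concurrence \<psi>"
  have v: "\<alpha> * B + \<gamma> * A = 2 * sqrt (1 + C\<^sup>2)"
    using eq by (simp only: chsh_value_linear A_def B_def C_def)
  then have v2: "(\<alpha> * B + \<gamma> * A)\<^sup>2 = 4 * (1 + C\<^sup>2)" by (simp add: power_mult_distrib add_nonneg_nonneg)
  have "(\<alpha> * B + \<gamma> * A)\<^sup>2 + (\<gamma> * B - \<alpha> * A)\<^sup>2 = (\<alpha>\<^sup>2 + \<gamma>\<^sup>2) * (A\<^sup>2 + B\<^sup>2)"
    by (simp add: power2_eq_square algebra_simps)
  then have "4 * (1 + C\<^sup>2) + (\<gamma> * B - \<alpha> * A)\<^sup>2 = 4 * (A\<^sup>2 + B\<^sup>2)" using v2 assms(4) by simp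
  moreover have "A\<^sup>2 + B\<^sup>2 \<le> 1 + C\<^sup>2"
    using correlations_bound(1)[OF assms(1)] by (simp add: A_def B_def C_def)
  moreover have "0 \<le> (\<gamma> * B - \<alpha> * A)\<^sup>2" by simp
  moreover have "s = 1 + c \<and> d = 0" if "4 * (1 + c) + d = 4 * s" "s \<le> 1 + c" "0 \<le> d" for c d s :: real
    using that by argo
  ultimately have AB: "A\<^sup>2 + B\<^sup>2 = 1 + C\<^sup>2" and "(\<gamma> * B - \<alpha> * A)\<^sup>2 = 0" by blast+
  then have gB: "\<gamma> * B = \<alpha> * A" by simp
  have g: "\<gamma> > 0" using assms(2-4) by (cases "\<gamma> = 0") auto
  \<comment> \<open>Parallelism turns \<gamma> times the value into 4\<open>A\<close>, so
    \<open>A\<close> inherits the positivity of the value.\<close>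
  have "\<gamma> * (\<alpha> * B + \<gamma> * A) = \<alpha> * (\<gamma> * B) + \<gamma>\<^sup>2 * A" by (simp add: power2_eq_square algebra_simps)
  also have "\<dots> = (\<alpha>\<^sup>2 + \<gamma>\<^sup>2) * A" unfolding gB by (simp add: power2_eq_square algebra_simps)
  finally have "\<gamma> * (2 * sqrt (1 + C\<^sup>2)) = 4 * A" using v assms(4) by simp
  moreover have "0 < \<gamma> * (2 * sqrt (1 + C\<^sup>2))" using g by (simp add: add_pos_nonneg)
  ultimately have A0: "0 < A" by linarith
  have B0: "0 \<le> B" using gB g A0 assms(2) by (metis mult_nonneg_nonneg less_imp_le zero_le_mult_iff not_le)
  have "\<gamma> * B \<le> \<gamma> * A" unfolding gB using assms(3) A0 by simp
  then have "B \<le> A" using g by simp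
  then have off: "\<psi>$(0,1) = 0" "\<psi>$(1,0) = 0"
    using correlations_bound(2)[OF assms(1)] AB A0 B0 by (auto simp: A_def B_def C_def)
  define r s where "r = cmod (\<psi>$(0,0))" and "s = cmod (\<psi>$(1,1))"
  have rs: "r\<^sup>2 + s\<^sup>2 = 1" using norm_qqvec[of \<psi>] assms(1) by (simp add: r_def s_def off)
  then have A1: "A = 1" by (simp add: A_def chsh_value_zz off r_def s_def)
  have "C = 2 * r * s" by (simp add: C_def concurrence_def off norm_mult r_def s_def)
  moreover have "B\<^sup>2 = C\<^sup>2" using AB A1 by simp
  ultimately have B1: "B = 2 * r * s"
    using B0 by (simp add: power2_eq_iff_nonneg r_def s_def)
  have grs: "\<gamma> * (2 * r * s) = \<alpha>" using gB A1 B1 by simp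
  define z where "z = cnj (\<psi>$(0,0)) * \<psi>$(1,1)"
  have cz: "cmod z = r * s" by (simp add: z_def norm_mult r_def s_def)
  \<comment> \<open>The real part of \<open>z\<close> equals its modulus, so \<open>z\<close> is a
    nonnegative real and the two amplitudes share a common phase.\<close>
  have "Re z = r * s" using B1 by (simp add: B_def chsh_value_xx off z_def)
  moreover from this have "(Im z)\<^sup>2 = 0" using cmod_power2[of z] unfolding cz by simp
  ultimately have z: "z = of_real (r * s)" by (simp add: complex_eq_iff)
  have "\<exists>c. cmod c = 1 \<and> \<psi>$(0,0) = c * of_real r \<and> \<psi>$(1,1) = c * of_real s"
  proof (cases "\<psi>$(0,0) = 0")
    case True
    then show ?thesis using complex_phase_exists[of "\<psi>$(1,1)"] by (simp add: r_def s_def)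
  next
    case False
    obtain c where c: "cmod c = 1" "\<psi>$(0,0) = c * of_real r"
      unfolding r_def using complex_phase_exists by blast
    have r0: "r \<noteq> 0" using False by (simp add: r_def)
    have cc: "c * cnj c = 1" using c(1) by (metis complex_norm_square of_real_1 power_one)
    have "of_real r * (cnj c * \<psi>$(1,1)) = of_real r * of_real s"
      using z by (simp add: z_def c(2) algebra_simps)
    then have "cnj c * \<psi>$(1,1) = of_real s" using r0 by simp
    then have "c * cnj c * \<psi>$(1,1) = c * of_real s" by (simp add: mult.assoc)
    then show ?thesis using c cc by (intro exI[of _ c]) simp
  qed
  then obtain c where "cmod c = 1" "\<psi>$(0,0) = c * of_real r" "\<psi>$(1,1) = c * of_real s" by blast
  then have "same_state \<psi> (complex_of_real r *s ket 0 0 + complex_of_real s *s ket 1 1)"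
    unfolding same_state_def
    by (intro exI[of _ c]) (simp add: qqvec_eq_iff ket_entries off)
  then show ?thesis using that[of r s] rs grs by (simp add: r_def s_def)
qed

text \<open>The signs of \<open>r\<close> and \<open>s\<close> are left free because cos \<theta> is
  negative beyond \<pi>/2. The opposite signs of the xx and yy correlations account for the minus
  sign in \<open>S_minus\<close>.\<close>

lemma schmidt_vector_facts:
  fixes r s :: real
  assumes "r\<^sup>2 + s\<^sup>2 = 1"
  defines "\<phi> \<equiv> complex_of_real r *s ket 0 0 + complex_of_real s *s ket 1 1"
  shows "norm \<phi> = 1" "concurrence \<phi> = \<bar>2 * r * s\<bar>"
    "chsh_value (dens \<phi>) (kron sigma_x sigma_x) = 2 * r * s"
    "chsh_value (dens \<phi>) (kron sigma_y sigma_y) = - (2 * r * s)"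
    "chsh_value (dens \<phi>) (kron sigma_z sigma_z) = 1"
proof -
  have "(norm \<phi>)\<^sup>2 = 1" using assms(1) unfolding norm_qqvec by (simp add: \<phi>_def ket_entries)
  then show "norm \<phi> = 1" by (simp add: power2_eq_1_iff) (smt (verit) norm_ge_zero)
qed (use assms(1) in \<open>simp_all add: \<phi>_def concurrence_def chsh_value_xx chsh_value_yy chsh_value_zz
      ket_entries norm_mult abs_mult\<close>)

lemma CHSH_coefficients: "(2 / sqrt (1 + \<sigma>\<^sup>2) * \<sigma>)\<^sup>2 + (2 / sqrt (1 + \<sigma>\<^sup>2))\<^sup>2 = 4"
proof -
  have "1 + \<sigma>\<^sup>2 > 0" by (simp add: add_pos_nonneg)
  then have "(2 / sqrt (1 + \<sigma>\<^sup>2) * \<sigma>)\<^sup>2 + (2 / sqrt (1 + \<sigma>\<^sup>2))\<^sup>2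
      = 4 * \<sigma>\<^sup>2 / (1 + \<sigma>\<^sup>2) + 4 / (1 + \<sigma>\<^sup>2)"
    by (simp add: power_divide power_mult_distrib)
  also have "\<dots> = (4 * \<sigma>\<^sup>2 + 4) / (1 + \<sigma>\<^sup>2)" by (rule add_divide_distrib[symmetric])
  also have "4 * \<sigma>\<^sup>2 + 4 = 4 * (1 + \<sigma>\<^sup>2)" by simp
  also have "4 * (1 + \<sigma>\<^sup>2) / (1 + \<sigma>\<^sup>2) = 4"
    using \<open>1 + \<sigma>\<^sup>2 > 0\<close> by (intro nonzero_mult_div_cancel_right) simp
  finally show ?thesis .
qed

lemma CHSH_coefficients_value: "2 / sqrt (1 + \<sigma>\<^sup>2) * \<sigma> * \<sigma> + 2 / sqrt (1 + \<sigma>\<^sup>2) = 2 * sqrt (1 + \<sigma>\<^sup>2)"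
proof -
  have p: "1 + \<sigma>\<^sup>2 > 0" by (simp add: add_pos_nonneg)
  have "2 / sqrt (1 + \<sigma>\<^sup>2) * \<sigma> * \<sigma> + 2 / sqrt (1 + \<sigma>\<^sup>2) = 2 * ((1 + \<sigma>\<^sup>2) / sqrt (1 + \<sigma>\<^sup>2))"
    by (simp add: add_divide_distrib power2_eq_square)
  also have "(1 + \<sigma>\<^sup>2) / sqrt (1 + \<sigma>\<^sup>2) = sqrt (1 + \<sigma>\<^sup>2)" using p by (simp add: real_div_sqrt)
  finally show ?thesis .
qed

lemma is_CHSH_xx_zz: "\<mu>\<^sup>2 + \<nu>\<^sup>2 = 4 \<Longrightarrow> is_CHSH (\<mu> *\<^sub>R kron sigma_x sigma_x + \<nu> *\<^sub>R kron sigma_z sigma_z)"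
  using is_CHSH_orthonormal[of "axis 1 1" "axis 3 1" "axis 1 1" "axis 3 1"]
  by (simp add: pauli_dot_axis inner_axis_axis)

lemma is_CHSH_yy_zz: "\<mu>\<^sup>2 + \<nu>\<^sup>2 = 4 \<Longrightarrow> is_CHSH (\<mu> *\<^sub>R kron sigma_y sigma_y + \<nu> *\<^sub>R kron sigma_z sigma_z)"
  using is_CHSH_orthonormal[of "axis 2 1" "axis 3 1" "axis 2 1" "axis 3 1"]
  by (simp add: pauli_dot_axis inner_axis_axis)

lemma unitary_mult_vec_cancel:
  assumes "unitary W" shows "cadj W *v (W *v \<psi>) = \<psi>" "W *v (cadj W *v \<psi>) = \<psi>"
  using assms by (simp_all add: matrix_vector_mul_assoc unitary_right) (simp add: unitary_def)

text \<open>The Schmidt form supplies an operator reaching the bound; the diagonal form of an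
  arbitrary CHSH operator shows that none exceeds it.\<close>

lemma nonlocality_pure:
  assumes "norm \<psi> = 1"
  shows "nonlocality (dens \<psi>) = 2 * sqrt (1 + (concurrence \<psi>)\<^sup>2)"
  unfolding nonlocality_def
proof (rule cSup_eq_maximum)
  obtain U V r s where UV: "unitary U" "unitary V" and "0 \<le> r" "0 \<le> s"
    and \<psi>: "\<psi> = kron U V *v (complex_of_real r *s ket 0 0 + complex_of_real s *s ket 1 1)"
    by (rule schmidt_decomposition)
  define \<phi> where "\<phi> = complex_of_real r *s ket 0 0 + complex_of_real s *s ket 1 1"
  have "norm \<phi> = 1" using assms norm_unitary[OF unitary_kron[OF UV]] \<psi> by (simp add: \<phi>_def)
  then have rs: "r\<^sup>2 + s\<^sup>2 = 1" using norm_qqvec[of \<phi>] by (simp add: \<phi>_def ket_entries)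
  define \<sigma> where "\<sigma> = 2 * r * s"
  define T where "T = (2 / sqrt (1 + \<sigma>\<^sup>2) * \<sigma>) *\<^sub>R kron sigma_x sigma_x + (2 / sqrt (1 + \<sigma>\<^sup>2)) *\<^sub>R kron sigma_z sigma_z"
  let ?S = "kron U V ** T ** cadj (kron U V)"
  have "chsh_value (dens \<psi>) ?S = chsh_value (dens \<phi>) T"
    unfolding \<psi> \<phi>_def by (rule chsh_value_unitary[OF unitary_kron[OF UV]])
  also have "\<dots> = 2 / sqrt (1 + \<sigma>\<^sup>2) * \<sigma> * \<sigma> + 2 / sqrt (1 + \<sigma>\<^sup>2)"
    unfolding T_def chsh_value_linear \<phi>_def schmidt_vector_facts[OF rs] by (simp add: \<sigma>_def)
  also have "\<dots> = 2 * sqrt (1 + \<sigma>\<^sup>2)" by (rule CHSH_coefficients_value)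
  also have "\<sigma>\<^sup>2 = (concurrence \<psi>)\<^sup>2"
    unfolding \<psi> concurrence_unitary[OF UV] schmidt_vector_facts[OF rs] by (simp add: \<sigma>_def)
  finally have val: "chsh_value (dens \<psi>) ?S = 2 * sqrt (1 + (concurrence \<psi>)\<^sup>2)" .
  have "is_CHSH T" unfolding T_def by (rule is_CHSH_xx_zz[OF CHSH_coefficients])
  then have "is_CHSH ?S" by (rule is_CHSH_unitary_conj[OF UV])
  then show "2 * sqrt (1 + (concurrence \<psi>)\<^sup>2) \<in> chsh_value (dens \<psi>) ` {S. is_CHSH S}"
    using val by (metis (mono_tags) image_eqI mem_Collect_eq)
next
  fix v assume "v \<in> chsh_value (dens \<psi>) ` {S. is_CHSH S}"
  then obtain S where S: "is_CHSH S" and v: "v = chsh_value (dens \<psi>) S" by blast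
  obtain U V \<alpha> \<gamma> where UV: "unitary U" "unitary V" and "0 \<le> \<alpha>" "\<alpha> \<le> \<gamma>" and ag: "\<alpha>\<^sup>2 + \<gamma>\<^sup>2 = 4"
    and Seq: "S = kron U V ** (\<alpha> *\<^sub>R kron sigma_x sigma_x + \<gamma> *\<^sub>R kron sigma_z sigma_z) ** cadj (kron U V)"
    by (rule CHSH_diagonal_form[OF S])
  define \<phi> where "\<phi> = cadj (kron U V) *v \<psi>"
  have W: "unitary (kron U V)" using UV by (rule unitary_kron)
  have \<psi>: "\<psi> = kron U V *v \<phi>" by (simp add: \<phi>_def unitary_mult_vec_cancel[OF W])
  have "norm \<phi> = 1" using assms norm_unitary[OF W] \<psi> by simp
  then show "v \<le> 2 * sqrt (1 + (concurrence \<psi>)\<^sup>2)"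
    using diagonal_value_le[OF _ ag, of \<phi>]
    unfolding v Seq \<psi> chsh_value_unitary[OF W] concurrence_unitary[OF UV] by blast
qed

text \<open>Moves optimality into the frame where the operator is diagonal, both sides of the
  equation being invariant under local unitaries.\<close>

lemma optimal_CHSH_conj_iff:
  assumes "unitary U" "unitary V" "norm \<phi> = 1" "is_CHSH S"
  shows "optimal_CHSH (dens (kron U V *v \<phi>)) (kron U V ** S ** cadj (kron U V)) \<longleftrightarrow>
    chsh_value (dens \<phi>) S = 2 * sqrt (1 + (concurrence \<phi>)\<^sup>2)"
proof -
  have W: "unitary (kron U V)" using assms(1,2) by (rule unitary_kron)
  have "norm (kron U V *v \<phi>) = 1" using assms(3) norm_unitary[OF W] by simp
  then show ?thesis
    unfolding optimal_CHSH_def using is_CHSH_unitary_conj[OF assms(1,2,4)]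
    by (simp add: nonlocality_pure concurrence_unitary[OF assms(1,2)] chsh_value_unitary[OF W])
qed

subsection \<open>States sharing an optimal operator\<close>

lemma same_state_sym: "same_state \<psi> \<phi> \<Longrightarrow> same_state \<phi> \<psi>"
proof -
  assume "same_state \<psi> \<phi>"
  then obtain c where c: "cmod c = 1" "\<psi> = c *s \<phi>" by (auto simp: same_state_def)
  have "c \<noteq> 0" using c(1) by auto
  then have "\<phi> = inverse c *s \<psi>" using c(2) by (simp add: vec_eq_iff)
  then show ?thesis unfolding same_state_def
    using c(1) by (intro exI[of _ "inverse c"]) (simp add: norm_inverse)
qed

lemma same_state_trans: "same_state \<psi> \<phi> \<Longrightarrow> same_state \<phi> \<eta> \<Longrightarrow> same_state \<psi> \<eta>"
  unfolding same_state_def by (metis mult.left_neutral norm_mult vector_smult_assoc)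

lemma same_state_mult: "same_state \<psi> \<phi> \<Longrightarrow> same_state (W *v \<psi>) (W *v \<phi>)"
  unfolding same_state_def by (auto simp: vector_scalar_commute)

text \<open>The hypotheses on \<open>r\<close> and \<open>s\<close> are symmetric, so the lemma
  serves both states of the theorem with the same operators.\<close>

lemma S_plus_minus_optimal:
  fixes r s :: real
  assumes "unitary U" "unitary V" "r\<^sup>2 + s\<^sup>2 = 1" "2 * r * s = sin (2 * \<theta>)"
    and "same_state \<psi> (kron U V *v (complex_of_real r *s ket 0 0 + complex_of_real s *s ket 1 1))"
  shows "optimal_CHSH (dens \<psi>) (kron U V ** S_plus \<theta> ** cadj (kron U V))"
    and "optimal_CHSH (dens \<psi>) (kron U V ** S_minus \<theta> ** cadj (kron U V))"
proof -
  define \<sigma> where "\<sigma> = sin (2 * \<theta>)"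
  define k where "k = 2 / sqrt (1 + \<sigma>\<^sup>2)"
  have kk: "(k * \<sigma>)\<^sup>2 + k\<^sup>2 = 4" "k * \<sigma> * \<sigma> + k = 2 * sqrt (1 + \<sigma>\<^sup>2)"
    unfolding k_def by (rule CHSH_coefficients, rule CHSH_coefficients_value)
  have kk': "(- (k * \<sigma>))\<^sup>2 + k\<^sup>2 = 4" using kk(1) by simp
  have plus: "S_plus \<theta> = (k * \<sigma>) *\<^sub>R kron sigma_x sigma_x + k *\<^sub>R kron sigma_z sigma_z"
    by (simp add: S_plus_def k_def \<sigma>_def scaleR_add_right)
  have minus: "S_minus \<theta> = (- (k * \<sigma>)) *\<^sub>R kron sigma_y sigma_y + k *\<^sub>R kron sigma_z sigma_z"
    by (simp add: S_minus_def k_def \<sigma>_def scaleR_diff_right)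
  note facts = schmidt_vector_facts[OF assms(3)]
  note iff = optimal_CHSH_conj_iff[OF assms(1,2) facts(1)]
  show "optimal_CHSH (dens \<psi>) (kron U V ** S_plus \<theta> ** cadj (kron U V))"
    unfolding dens_same_state[OF assms(5)] plus iff[OF is_CHSH_xx_zz[OF kk(1)]] chsh_value_linear facts
    using kk(2) by (simp add: assms(4) \<sigma>_def)
  show "optimal_CHSH (dens \<psi>) (kron U V ** S_minus \<theta> ** cadj (kron U V))"
    unfolding dens_same_state[OF assms(5)] minus iff[OF is_CHSH_yy_zz[OF kk']] chsh_value_linear facts
    using kk(2) by (simp add: assms(4) \<sigma>_def)
qed

text \<open>Nonnegativity recovers the sum from its square, so both pairs are the roots of one
  quadratic.\<close>

lemma same_sum_and_product_of_squares:
  fixes r s r' s' :: real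
  assumes "0 \<le> r" "0 \<le> s" "0 \<le> r'" "0 \<le> s'"
    and "r\<^sup>2 + s\<^sup>2 = r'\<^sup>2 + s'\<^sup>2" "r * s = r' * s'"
  shows "r' = r \<and> s' = s \<or> r' = s \<and> s' = r"
proof -
  have "(r + s)\<^sup>2 = (r' + s')\<^sup>2" using assms(5,6) by (simp add: power2_sum)
  then have sum: "r + s = r' + s'" using assms(1-4) by (simp add: power2_eq_iff_nonneg)
  then have s': "s' = r + s - r'" by simp
  have "(r' - r) * (r' - s) = 0" using assms(6) unfolding s' by (simp add: algebra_simps)
  then show ?thesis using s' by auto
qed

lemma same_optimal_CHSH_schmidt:
  assumes "norm \<psi> = 1" "norm \<psi>' = 1" "\<not> same_state \<psi> \<psi>'"
    and "same_optimal_CHSH (dens \<psi>) (dens \<psi>')"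
  obtains U V r s where "unitary U" "unitary V" "0 \<le> r" "0 \<le> s" "r\<^sup>2 + s\<^sup>2 = 1"
    "same_state \<psi> (kron U V *v (complex_of_real r *s ket 0 0 + complex_of_real s *s ket 1 1))"
    "same_state \<psi>' (kron U V *v (complex_of_real s *s ket 0 0 + complex_of_real r *s ket 1 1))"
proof -
  obtain S where S: "optimal_CHSH (dens \<psi>) S" "optimal_CHSH (dens \<psi>') S"
    using assms(4) by (auto simp: same_optimal_CHSH_def)
  then have "is_CHSH S" by (simp add: optimal_CHSH_def)
  then obtain U V \<alpha> \<gamma> where UV: "unitary U" "unitary V" and ag: "0 \<le> \<alpha>" "\<alpha> \<le> \<gamma>" "\<alpha>\<^sup>2 + \<gamma>\<^sup>2 = 4"
    and Seq: "S = kron U V ** (\<alpha> *\<^sub>R kron sigma_x sigma_x + \<gamma> *\<^sub>R kron sigma_z sigma_z) ** cadj (kron U V)"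
    by (rule CHSH_diagonal_form)
  have W: "unitary (kron U V)" using UV by (rule unitary_kron)
  \<comment> \<open>The frame \<open>U\<close>, \<open>V\<close> and the ratio \<alpha>/\<gamma>
    come from \<open>S\<close> alone, so every state for which \<open>S\<close> is optimal has its
    Schmidt form in this one frame with the same product \<open>r * s\<close>.\<close>
  have main: "\<exists>r s. 0 \<le> r \<and> 0 \<le> s \<and> r\<^sup>2 + s\<^sup>2 = 1 \<and> \<gamma> * (2 * r * s) = \<alpha> \<and>
      same_state \<phi> (kron U V *v (complex_of_real r *s ket 0 0 + complex_of_real s *s ket 1 1))"
    if \<phi>: "norm \<phi> = 1" "optimal_CHSH (dens \<phi>) S" for \<phi>
  proof -
    define \<eta> where "\<eta> = cadj (kron U V) *v \<phi>"
    have e: "\<phi> = kron U V *v \<eta>" by (simp add: \<eta>_def unitary_mult_vec_cancel[OF W])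
    have n: "norm \<eta> = 1" using \<phi>(1) norm_unitary[OF W] e by simp
    have "chsh_value (dens \<eta>) (\<alpha> *\<^sub>R kron sigma_x sigma_x + \<gamma> *\<^sub>R kron sigma_z sigma_z)
        = 2 * sqrt (1 + (concurrence \<eta>)\<^sup>2)"
      using \<phi>(2) unfolding e Seq optimal_CHSH_conj_iff[OF UV n is_CHSH_xx_zz[OF ag(3)]] .
    then obtain r s where "0 \<le> r" "0 \<le> s" "r\<^sup>2 + s\<^sup>2 = 1" "\<gamma> * (2 * r * s) = \<alpha>"
      "same_state \<eta> (complex_of_real r *s ket 0 0 + complex_of_real s *s ket 1 1)"
      by (rule diagonal_value_eq[OF n ag])
    then show ?thesis unfolding e using same_state_mult by blast
  qed
  obtain r s where rs: "0 \<le> r" "0 \<le> s" "r\<^sup>2 + s\<^sup>2 = 1" "\<gamma> * (2 * r * s) = \<alpha>"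
    and \<psi>: "same_state \<psi> (kron U V *v (complex_of_real r *s ket 0 0 + complex_of_real s *s ket 1 1))"
    using main[OF assms(1) S(1)] by blast
  obtain r' s' where rs': "0 \<le> r'" "0 \<le> s'" "r'\<^sup>2 + s'\<^sup>2 = 1" "\<gamma> * (2 * r' * s') = \<alpha>"
    and \<psi>': "same_state \<psi>' (kron U V *v (complex_of_real r' *s ket 0 0 + complex_of_real s' *s ket 1 1))"
    using main[OF assms(2) S(2)] by blast
  have "\<gamma> \<noteq> 0" using ag by auto
  then have "r * s = r' * s'" using rs(4) rs'(4) by auto
  then have "r' = r \<and> s' = s \<or> r' = s \<and> s' = r"
    using same_sum_and_product_of_squares[OF rs(1,2) rs'(1,2)] rs(3) rs'(3) by simp
  \<comment> \<open>Equal coefficients would make the two states coincide, which leaves only the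
    exchange.\<close>
  moreover have "\<not> (r' = r \<and> s' = s)"
    using assms(3) \<psi> \<psi>' same_state_trans same_state_sym by blast
  ultimately have "r' = s" "s' = r" by auto
  then show ?thesis using that[OF UV rs(1-3) \<psi>] \<psi>' by simp
qed

theorem theorem2:
  fixes \<psi> \<psi>' :: qqvec
  assumes "norm \<psi> = 1" and "norm \<psi>' = 1" and "\<not> same_state \<psi> \<psi>'"
  shows "(same_optimal_CHSH (dens \<psi>) (dens \<psi>') \<longleftrightarrow>
           (\<exists>UA UB :: qop. \<exists>\<theta>::real. unitary UA \<and> unitary UB \<and> 0 \<le> \<theta> \<and> \<theta> < pi \<and>
              same_state \<psi> (kron UA UB *v (cos \<theta> *s ket 0 0 + sin \<theta> *s ket 1 1)) \<and>
              same_state \<psi>' (kron UA UB *v (sin \<theta> *s ket 0 0 + cos \<theta> *s ket 1 1))))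
       \<and> (\<forall>UA UB :: qop. \<forall>\<theta>::real. unitary UA \<and> unitary UB \<and> 0 \<le> \<theta> \<and> \<theta> < pi \<and>
              same_state \<psi> (kron UA UB *v (cos \<theta> *s ket 0 0 + sin \<theta> *s ket 1 1)) \<and>
              same_state \<psi>' (kron UA UB *v (sin \<theta> *s ket 0 0 + cos \<theta> *s ket 1 1)) \<longrightarrow>
            optimal_CHSH (dens \<psi>) (kron UA UB ** S_plus \<theta> ** cadj (kron UA UB)) \<and>
            optimal_CHSH (dens \<psi>') (kron UA UB ** S_plus \<theta> ** cadj (kron UA UB)) \<and>
            optimal_CHSH (dens \<psi>) (kron UA UB ** S_minus \<theta> ** cadj (kron UA UB)) \<and>
            optimal_CHSH (dens \<psi>') (kron UA UB ** S_minus \<theta> ** cadj (kron UA UB)))"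
  (is "(?same \<longleftrightarrow> (\<exists>UA UB \<theta>. ?P UA UB \<theta>)) \<and> (\<forall>UA UB \<theta>. ?P UA UB \<theta> \<longrightarrow> ?Q UA UB \<theta>)")
proof -
  \<comment> \<open>Proved first because it also settles the converse direction:
    \<open>S_plus\<close> conjugated is a common optimal operator.\<close>
  have Q: "?Q UA UB \<theta>" if P: "?P UA UB \<theta>" for UA UB \<theta>
  proof -
    have U: "unitary UA" "unitary UB" using P by blast+
    have p: "(cos \<theta>)\<^sup>2 + (sin \<theta>)\<^sup>2 = 1" "(sin \<theta>)\<^sup>2 + (cos \<theta>)\<^sup>2 = 1" by simp_all
    have d: "2 * cos \<theta> * sin \<theta> = sin (2 * \<theta>)" "2 * sin \<theta> * cos \<theta> = sin (2 * \<theta>)"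
      by (simp_all add: sin_double)
    have st: "same_state \<psi> (kron UA UB *v (complex_of_real (cos \<theta>) *s ket 0 0 + complex_of_real (sin \<theta>) *s ket 1 1))"
      "same_state \<psi>' (kron UA UB *v (complex_of_real (sin \<theta>) *s ket 0 0 + complex_of_real (cos \<theta>) *s ket 1 1))"
      using P by (simp_all add: cos_of_real sin_of_real)
    show ?thesis
      using S_plus_minus_optimal[OF U p(1) d(1) st(1)] S_plus_minus_optimal[OF U p(2) d(2) st(2)]
      by blast
  qed
  have "?same \<longleftrightarrow> (\<exists>UA UB \<theta>. ?P UA UB \<theta>)"
  proof
    assume ?same
    then obtain U V r s where UV: "unitary U" "unitary V" and rs: "0 \<le> r" "0 \<le> s" "r\<^sup>2 + s\<^sup>2 = 1"
      and st: "same_state \<psi> (kron U V *v (complex_of_real r *s ket 0 0 + complex_of_real s *s ket 1 1))"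
      "same_state \<psi>' (kron U V *v (complex_of_real s *s ket 0 0 + complex_of_real r *s ket 1 1))"
      by (rule same_optimal_CHSH_schmidt[OF assms])
    \<comment> \<open>Nonnegative Schmidt coefficients place the angle in the first quadrant, inside
      the required range.\<close>
    obtain \<theta> where \<theta>: "0 \<le> \<theta>" "\<theta> \<le> pi / 2" "r = cos \<theta>" "s = sin \<theta>"
      using sincos_total_pi_half[OF rs] by blast
    have "\<theta> < pi" using \<theta>(2) pi_gt_zero by linarith
    then have "?P U V \<theta>" using UV \<theta>(1) st unfolding \<theta>(3,4) by (simp add: cos_of_real sin_of_real)
    then show "\<exists>UA UB \<theta>. ?P UA UB \<theta>" by blast
  next
    assume "\<exists>UA UB \<theta>. ?P UA UB \<theta>"
    then obtain UA UB \<theta> where "?P UA UB \<theta>" by blast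
    from Q[OF this] show ?same unfolding same_optimal_CHSH_def by blast
  qed
  then show ?thesis using Q by blast
qed

end
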